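(* Let $\mathbb{F}$ be a field of characteristic $\ne2$, let $d=d(n)$, and let $(M_n)$ be a sequence of $n^d\times n^d$ matrices over $\mathbb{F}$ such that the sequence $(\mathrm{ShiftedTensor}(M_n))$ is in $\mathsf{VBP_{ord}}$. Then there is a constant $C$ such that $\mathrm{PT\text{-}rank}(M_n)\le n^{0.81d+C}$ for all $n$.
   Context: $\mathrm{ShiftedTensor}(M):[n^2]^{d+1}\to\mathbb{F}$, $\mathrm{ShiftedTensor}(M)(\langle p,i_1\rangle,\langle j_1,i_2\rangle,\dots,\langle j_{d-1},i_d\rangle,\langle j_d,q\rangle)=\mathbb 1\{p=q=1\}M_{(i_1,\dots,i_d),(j_1,\dots,j_d)}$, with $\langle i,j\rangle=(i-1)n+j$; it corresponds to the set-multilinear polynomial $\sum_a \mathrm{ShiftedTensor}(M)(a)X^{(1)}_{a_1}\cdots X^{(d+1)}_{a_{d+1}}$ in blocks $X^{(1)},\dots,X^{(d+1)}$ of $n^2$ variables. An ordered algebraic branching program for a set-multilinear $f$ in ordered blocks $X^{(1)},\dots,X^{(m)}$ is a representation $f=v_1^{\mathsf T}M_1\cdots M_mv_2$ with $v_1\in\mathbb{F}^{w_0}$, $v_2\in\mathbb{F}^{w_m}$, and $M_i$ a $w_{i-1}\times w_i$ matrix of linear forms in $X^{(i)}$; its size is $\sum_i w_i$. $\mathsf{VBP_{ord}}$ is the class of sequences of set-multilinear polynomials in $N$ variables computable by ordered ABPs of size $N^{O(1)}$. Partial transposes $M^{\top_\kappa}$ ($\kappa\subseteq[d]$) swap the row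 and column indices in the coordinates $k\in\kappa$; $M$ is PT-basic if some $M^{\top_\kappa}$ has rank 1; $\mathrm{PT\text{-}rank}(M)$ is the least number of PT-basic matrices summing to $M$. *)

theory Defs
  imports Complex_Main
begin

text \<open>Conventions: all indices are 0-based. A tuple in [n]^d is a list of length d
with entries < n. An n^d x n^d matrix (rows and columns indexed by [n]^d) is a function
nat list => nat list => 'a, of which only the values on idx n d x idx n d matter.\<close>

definition idx :: "nat \<Rightarrow> nat \<Rightarrow> nat list set" where
  "idx n d = {xs. length xs = d \<and> (\<forall>x\<in>set xs. x < n)}"

text \<open>ShiftedTensor(M) : [n^2]^(d+1) -> F, with the pairing <i,j> = i*n + j (0-based).
For a = (a_0,...,a_d): p = a_0 div n, i_k = a_(k-1) mod n, j_k = a_k div n, q = a_d mod n.\<close>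

definition shifted_tensor :: "nat \<Rightarrow> nat \<Rightarrow> (nat list \<Rightarrow> nat list \<Rightarrow> 'a::zero) \<Rightarrow> nat list \<Rightarrow> 'a" where
  "shifted_tensor n d M a =
     (if a ! 0 div n = 0 \<and> a ! d mod n = 0
      then M (map (\<lambda>k. a ! k mod n) [0..<d]) (map (\<lambda>k. a ! (Suc k) div n) [0..<d])
      else 0)"

text \<open>Ordered ABP. Widths w 0, ..., w m; v1 in F^(w 0); v2 in F^(w m);
for block i (1..m), the matrix M_i of linear forms in X^(i) is given by its coefficient
matrices: entry (r,c) of M_i is  sum_a A i a r c * X^(i)_a.
Since products of linear forms in distinct blocks are set-multilinear, the coefficient of
X^(1)_(a_1) ... X^(m)_(a_m) in v1^T M_1 ... M_m v2 is v1^T A_1(a_1) ... A_m(a_m) v2;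
a set-multilinear polynomial is identified with its coefficient tensor.\<close>

fun abp_vec :: "(nat \<Rightarrow> nat) \<Rightarrow> (nat \<Rightarrow> 'a::comm_semiring_1) \<Rightarrow> (nat \<Rightarrow> nat \<Rightarrow> nat \<Rightarrow> nat \<Rightarrow> 'a)
                 \<Rightarrow> nat list \<Rightarrow> nat \<Rightarrow> nat \<Rightarrow> 'a" where
  "abp_vec w v1 A a 0 = v1"
| "abp_vec w v1 A a (Suc k) = (\<lambda>c. \<Sum>r<w k. abp_vec w v1 A a k r * A (Suc k) (a ! k) r c)"

definition abp_eval :: "(nat \<Rightarrow> nat) \<Rightarrow> (nat \<Rightarrow> 'a::comm_semiring_1) \<Rightarrow> (nat \<Rightarrow> 'a)
                 \<Rightarrow> (nat \<Rightarrow> nat \<Rightarrow> nat \<Rightarrow> nat \<Rightarrow> 'a) \<Rightarrow> nat \<Rightarrow> nat list \<Rightarrow> 'a" where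
  "abp_eval w v1 v2 A m a = (\<Sum>c<w m. abp_vec w v1 A a m c * v2 c)"

definition has_ord_abp :: "nat \<Rightarrow> nat \<Rightarrow> (nat list \<Rightarrow> 'a::comm_semiring_1) \<Rightarrow> nat \<Rightarrow> bool" where
  "has_ord_abp m s T S \<longleftrightarrow>
     (\<exists>w v1 v2 A. (\<Sum>i\<le>m. w i) \<le> S \<and> (\<forall>a\<in>idx s m. T a = abp_eval w v1 v2 A m a))"

text \<open>VBP_ord: the sequence (indexed by n >= 1) of set-multilinear polynomials, the n-th in
m n blocks of s n variables (N = m n * s n variables), has ordered ABPs of size N^O(1).\<close>

definition in_VBP_ord :: "(nat \<Rightarrow> nat) \<Rightarrow> (nat \<Rightarrow> nat) \<Rightarrow> (nat \<Rightarrow> nat list \<Rightarrow> 'a::comm_semiring_1) \<Rightarrow> bool" where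
  "in_VBP_ord m s f \<longleftrightarrow>
     (\<exists>c::nat. \<forall>n\<ge>1. has_ord_abp (m n) (s n) (f n) (c * (m n * s n) ^ c))"

definition ptrans :: "nat set \<Rightarrow> (nat list \<Rightarrow> nat list \<Rightarrow> 'a) \<Rightarrow> nat list \<Rightarrow> nat list \<Rightarrow> 'a" where
  "ptrans \<kappa> M r c =
     M (map (\<lambda>k. if k \<in> \<kappa> then c ! k else r ! k) [0..<length r])
       (map (\<lambda>k. if k \<in> \<kappa> then r ! k else c ! k) [0..<length c])"

definition rank_one :: "nat \<Rightarrow> nat \<Rightarrow> (nat list \<Rightarrow> nat list \<Rightarrow> 'a::field) \<Rightarrow> bool" where
  "rank_one n d M \<longleftrightarrow>
     (\<exists>r\<in>idx n d. \<exists>c\<in>idx n d. M r c \<noteq> 0) \<and>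
     (\<exists>u v. \<forall>r\<in>idx n d. \<forall>c\<in>idx n d. M r c = u r * v c)"

definition PT_basic :: "nat \<Rightarrow> nat \<Rightarrow> (nat list \<Rightarrow> nat list \<Rightarrow> 'a::field) \<Rightarrow> bool" where
  "PT_basic n d M \<longleftrightarrow> (\<exists>\<kappa>. \<kappa> \<subseteq> {..<d} \<and> rank_one n d (ptrans \<kappa> M))"

definition PT_rank :: "nat \<Rightarrow> nat \<Rightarrow> (nat list \<Rightarrow> nat list \<Rightarrow> 'a::field) \<Rightarrow> nat" where
  "PT_rank n d M = (LEAST r. \<exists>Ms. length Ms = r \<and> (\<forall>B\<in>set Ms. PT_basic n d B) \<and>
       (\<forall>i\<in>idx n d. \<forall>j\<in>idx n d. M i j = (\<Sum>B\<leftarrow>Ms. B i j)))"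

end

theory Submission
  imports Defs "HOL-Library.Function_Algebras"
begin

text \<open>
Cutting the branching program at two places, and fixing the row and column index of the tensor
factor at each cut, writes \<open>M\<close> as a sum of polynomially many products
\<open>F\<^sub>1 \<otimes> F\<^sub>2 \<otimes> F\<^sub>3\<close> of arbitrary matrices on thirds of the coordinates. Contracting with the
\<open>F\<^sub>i\<close> preserves cuts, so it suffices to decompose the identity on \<open>V \<otimes> V \<otimes> V\<close> with
\<open>dim V = 2\<^sup>s\<close>, using only partial transposes of the first and the third factor.

Let \<open>V\<close> be a Clifford module with \<open>2s\<close> generators. The tensors
\<open>\<Sum> c(|A|,|B|) \<gamma>\<^sub>A \<otimes> \<gamma>\<^sub>A \<gamma>\<^sub>B \<otimes> \<gamma>\<^sub>B\<close> (\<open>A, B\<close> disjoint and even) contain the identity. In the Bell basis of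
two factors such a tensor becomes, for each of the three admissible cuts, an \<open>S\<^bsub>2s\<^esub>\<close>-invariant operator
on \<open>(F\<^sup>2)\<^bsup>2s\<^esup>\<close> tensored with an identity of size \<open>2\<^sup>s\<close>. If the operator kills \<open>k\<close> disjoint singlets,
its rank is at most the number of 01-words with fewer than \<open>k\<close> matched parentheses. Singlets act on \<open>c\<close>
through the determinant of the \<open>2\<times>2\<close> blocks; on the squares \<open>a, b, c\<close> of the three letters the
determinants for the three cuts are \<open>a - b - c\<close>, \<open>a + b - c\<close> and \<open>a - b + c\<close>, which are linearly
independent when \<open>2 \<noteq> 0\<close>. Expanding \<open>a\<^sup>s\<close> in monomials of these three forms, each monomial has an exponent
at most \<open>s/3\<close>, so each summand kills \<open>s/3 + 1\<close> singlets in some cut. A Chernoff bound with parameter \<open>1/8\<close>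
gives \<open>(81/16)\<^sup>s\<close> terms up to polynomial factors, and \<open>log\<^sub>2 (81/16) / 3 < 0.81\<close>.
\<close>

section \<open>Words and straightening\<close>

definition words :: "nat \<Rightarrow> bool list set" where
  "words m = {xs. length xs = m}"

lemma words_0 [simp]: "words 0 = {[]}"
  by (auto simp: words_def)

lemma words_Suc: "words (Suc m) = (#) False ` words m \<union> (#) True ` words m"
  by (auto simp: words_def length_Suc_conv image_iff)

lemma finite_words [simp]: "finite (words m)"
  by (induction m) (auto simp: words_Suc)

lemma sum_words_Suc:
  "(\<Sum>x\<in>words (Suc m). f x) = (\<Sum>x\<in>words m. f (False # x)) + (\<Sum>x\<in>words m. f (True # x) :: 'b::comm_monoid_add)"
  unfolding words_Suc
  by (subst sum.union_disjoint) (auto simp: sum.reindex)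

lemma card_words: "card (words m) = 2 ^ m"
proof -
  have "card (words m) = (\<Sum>x\<in>words m. 1)"
    by simp
  also have "\<dots> = 2 ^ m"
    by (induction m) (simp_all only: sum_words_Suc, simp_all)
  finally show ?thesis .
qed

definition bsign :: "bool \<Rightarrow> 'a::comm_ring_1" where
  "bsign b = (if b then -1 else 1)"

lemma bsign_simps [simp]: "bsign True = -1" "bsign False = 1"
  by (simp_all add: bsign_def)

text \<open>The row-column entry of an operator on \<open>(F\<^sup>2)\<^sup>m\<close> in the span of words in the letters \<open>1\<close>, \<open>X\<close>
(the flip) and \<open>Z = diag(1,-1)\<close>, where a word has a coefficient depending only on the numbers
\<open>p, q, r\<close> of its letters \<open>1, X, Z\<close>.\<close>

fun kmat :: "(nat \<Rightarrow> nat \<Rightarrow> nat \<Rightarrow> 'a::comm_ring_1) \<Rightarrow> nat \<Rightarrow> nat \<Rightarrow> nat \<Rightarrow> bool list \<Rightarrow> bool list \<Rightarrow> 'a" where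
  "kmat c p q r [] [] = c p q r"
| "kmat c p q r (x # xs) (y # ys) =
     (if x = y then kmat c (Suc p) q r xs ys + bsign y * kmat c p q (Suc r) xs ys else kmat c p (Suc q) r xs ys)"
| "kmat c p q r _ _ = 0"

text \<open>Read \<open>c\<close> as the functional sending the monomial with exponents
  \<open>p, q, r\<close> to \<open>c p q r\<close>. This is its composite with multiplication by
  \<open>x^2 - y^2 - z^2\<close>, the determinant of the block
  \<open>x 1 + y X + z Z\<close>.\<close>

definition detshift :: "(nat \<Rightarrow> nat \<Rightarrow> nat \<Rightarrow> 'a::comm_ring_1) \<Rightarrow> nat \<Rightarrow> nat \<Rightarrow> nat \<Rightarrow> 'a" where
  "detshift c p q r = c (p + 2) q r - c p (q + 2) r - c p q (r + 2)"

lemma kmat_length: "length xs \<noteq> length ys \<Longrightarrow> kmat c p q r xs ys = 0"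
  by (induction c p q r xs ys rule: kmat.induct) auto

lemma kmat_detshift: "kmat (detshift c) p q r xs ys
    = kmat c (Suc (Suc p)) q r xs ys - kmat c p (Suc (Suc q)) r xs ys - kmat c p q (Suc (Suc r)) xs ys"
proof (induction "detshift c" p q r xs ys rule: kmat.induct)
  case (2 p q r x xs y ys)
  then show ?case by (cases "x = y"; cases y) simp_all
qed (simp_all add: detshift_def)

lemma kmat_zero: "(\<And>p q r. c p q r = 0) \<Longrightarrow> kmat c p q r xs ys = 0"
  by (induction c p q r xs ys rule: kmat.induct) auto

text \<open>Applied to the antisymmetric combination of 01 and 10 at two positions, equal pairs of
letters act through their determinants, and unequal letters cancel.\<close>

lemma kmat_swap:
  "length xs = length u \<Longrightarrow>
   kmat c p q r (xs @ a # b # zs) (u @ False # True # v) - kmat c p q r (xs @ a # b # zs) (u @ True # False # v)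
   = (of_bool (\<not> a \<and> b) - of_bool (a \<and> \<not> b)) * kmat (detshift c) p q r (xs @ zs) (u @ v)"
proof (induction xs u arbitrary: p q r rule: list_induct2)
  case Nil
  show ?case by (cases a; cases b) (simp_all add: kmat_detshift)
next
  case (Cons x xs y ys)
  show ?case
    using Cons.IH[of "Suc p" q r] Cons.IH[of p "Suc q" r] Cons.IH[of p q "Suc r"]
    by (cases "x = y"; cases y) (simp_all add: right_diff_distrib distrib_left eq_diff_eq diff_eq_eq add_ac)
qed

text \<open>The number of matched parentheses when \<open>False\<close> opens and \<open>True\<close> closes, with \<open>h\<close> parentheses
already open.\<close>

fun matched :: "nat \<Rightarrow> bool list \<Rightarrow> nat" where
  "matched h [] = 0"
| "matched h (False # w) = matched (Suc h) w"
| "matched 0 (True # w) = matched 0 w"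
| "matched (Suc h) (True # w) = Suc (matched h w)"

lemma matched_remove: "matched h (u @ False # True # v) = Suc (matched h (u @ v))"
  by (induction h u rule: matched.induct) auto

text \<open>Such a word is a run of \<open>True\<close> followed by a run of \<open>False\<close>,
  so every closer comes while nothing is open.\<close>

lemma matched_no_adjacent: "(\<nexists>u v. w = u @ False # True # v) \<Longrightarrow> matched 0 w = 0"
proof (induction w)
  case (Cons x w)
  have *: "\<nexists>u v. w = u @ False # True # v"
  proof safe
    fix u v assume "w = u @ False # True # v"
    then have "x # w = (x # u) @ False # True # v" by simp
    with Cons.prems show False by blast
  qed
  show ?case
  proof (cases x)
    case True
    then show ?thesis using Cons.IH[OF *] by simp
  next
    case False
    have allF: "\<forall>w h. (\<nexists>u v. False # w = u @ False # True # v) \<longrightarrow> matched h w = 0"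
    proof
      fix w :: "bool list"
      show "\<forall>h. (\<nexists>u v. False # w = u @ False # True # v) \<longrightarrow> matched h w = 0"
      proof (induction w)
        case (Cons y w)
        show ?case
        proof (intro allI impI)
          fix h assume no: "\<nexists>u v. False # y # w = u @ False # True # v"
          have no': "False # y # w \<noteq> u @ False # True # v" for u v
            using no by blast
          have "\<not> y" using no'[of "[]" w] by simp
          moreover have "\<nexists>u v. False # w = u @ False # True # v"
            using no'[of "False # u" for u] \<open>\<not> y\<close> by simp
          ultimately show "matched h (y # w) = 0" using Cons.IH by simp
        qed
      qed simp
    qed
    show ?thesis using allF Cons.prems False by simp
  qed
qed simp

section \<open>Lexicographic order and straightening of columns\<close>

fun binval :: "bool list \<Rightarrow> nat" where
  "binval [] = 0"
| "binval (b # w) = of_bool b * 2 ^ length w + binval w"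

lemma binval_less: "binval w < 2 ^ length w"
  by (induction w) auto

lemma binval_append: "binval (u @ v) = binval u * 2 ^ length v + binval v"
  by (induction u) (auto simp: algebra_simps power_add)

text \<open>On words of equal length \<open>binval\<close> is the lexicographic order. Either the
  prefixes decide, or they agree, the inserted blocks are weakly ordered and the suffixes
  decide.\<close>

lemma binval_insert:
  assumes len: "length u' = length u" "length v' = length v" "length x' = length x"
    and lt: "binval (u @ v) < binval (u' @ v')" and le: "binval x \<le> binval x'"
  shows "binval (u @ x @ v) < binval (u' @ x' @ v')"
proof -
  have v: "binval v < 2 ^ length v" "binval v' < 2 ^ length v"
    using binval_less[of v] binval_less[of v'] len by auto
  have x: "binval x < 2 ^ length x"
    by (rule binval_less)
  have xv: "binval (x @ v) < 2 ^ (length x + length v)"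
    using binval_less[of "x @ v"] by simp
  have *: "binval u * 2 ^ length v + binval v < binval u' * 2 ^ length v + binval v'"
    using lt len by (simp add: binval_append)
  consider "binval u < binval u'" | "binval u = binval u'" "binval v < binval v'"
  proof (cases "binval u < binval u'")
    case False
    have "binval u = binval u'"
    proof (rule ccontr)
      assume "binval u \<noteq> binval u'"
      with False have "Suc (binval u') \<le> binval u" by simp
      then have "Suc (binval u') * 2 ^ length v \<le> binval u * 2 ^ length v"
        by (rule mult_right_mono) simp
      with * v show False by simp
    qed
    with * that show ?thesis by simp
  qed (use that in simp)
  then show ?thesis
  proof cases
    case 1
    then have "Suc (binval u) * 2 ^ (length x + length v) \<le> binval u' * 2 ^ (length x + length v)"
      by (intro mult_right_mono) simp_all
    with xv have "binval u * 2 ^ (length x + length v) + binval (x @ v) < binval u' * 2 ^ (length x + length v)"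
      by simp
    then show ?thesis using len
      by (subst (1 2) binval_append) simp
  next
    case 2
    have "binval x * 2 ^ length v \<le> binval x' * 2 ^ length v"
      using le by simp
    from add_le_less_mono[OF this 2(2)] show ?thesis
      using 2(1) len by (simp add: binval_append)
  qed
qed

interpretation fs: vector_space "\<lambda>(a::'a::field) (f::'i \<Rightarrow> 'a) x. a * f x"
  by unfold_locales (auto simp: algebra_simps fun_eq_iff)

definition kcol :: "(nat \<Rightarrow> nat \<Rightarrow> nat \<Rightarrow> 'a::field) \<Rightarrow> bool list \<Rightarrow> nat \<times> nat \<times> nat \<times> bool list \<Rightarrow> 'a" where
  "kcol c w = (\<lambda>(p, q, r, xs). kmat c p q r xs w)"

text \<open>Tensoring with the singlet \<open>01 - 10\<close> at positions \<open>m\<close> and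
  \<open>m + 1\<close> of row words of length \<open>l\<close>. Being linear, it carries span
  statements for \<open>detshift c\<close> over to \<open>c\<close>.\<close>

definition kinsert :: "nat \<Rightarrow> nat \<Rightarrow> (nat \<times> nat \<times> nat \<times> bool list \<Rightarrow> 'a::field)
    \<Rightarrow> nat \<times> nat \<times> nat \<times> bool list \<Rightarrow> 'a" where
  "kinsert m l f = (\<lambda>(p, q, r, xs). if length xs = l
      then (of_bool (\<not> xs ! m \<and> xs ! Suc m) - of_bool (xs ! m \<and> \<not> xs ! Suc m))
           * f (p, q, r, take m xs @ drop (m + 2) xs) else 0)"

lemma kinsert_add: "kinsert m l (f + g) = kinsert m l f + kinsert m l g"
  by (auto simp: kinsert_def fun_eq_iff algebra_simps)

lemma kinsert_scale: "kinsert m l (\<lambda>x. a * f x) = (\<lambda>x. a * kinsert m l f x)"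
  by (auto simp: kinsert_def fun_eq_iff algebra_simps)

lemma kinsert_kcol:
  fixes c :: "nat \<Rightarrow> nat \<Rightarrow> nat \<Rightarrow> 'a::field"
  shows "kinsert (length u) (length u + length v + 2) (kcol (detshift c) (u @ v))
    = kcol c (u @ False # True # v) - kcol c (u @ True # False # v)"
proof
  fix t :: "nat \<times> nat \<times> nat \<times> bool list"
  obtain p q r xs where t: "t = (p, q, r, xs)"
    by (cases t)
  show "kinsert (length u) (length u + length v + 2) (kcol (detshift c) (u @ v)) t
    = (kcol c (u @ False # True # v) - kcol c (u @ True # False # v)) t"
  proof (cases "length xs = length u + length v + 2")
    case True
    define x a b z where "x = take (length u) xs" and "a = xs ! length u" and "b = xs ! Suc (length u)"
      and "z = drop (length u + 2) xs"
    have xs: "xs = x @ a # b # z"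
      using True by (simp add: x_def a_def b_def z_def Cons_nth_drop_Suc)
    have "length x = length u"
      using True by (simp add: x_def)
    have "kinsert (length u) (length u + length v + 2) (kcol (detshift c) (u @ v)) t
      = (of_bool (\<not> a \<and> b) - of_bool (a \<and> \<not> b)) * kmat (detshift c) p q r (x @ z) (u @ v)"
      using True by (simp only: t kinsert_def kcol_def prod.case a_def b_def x_def z_def if_True refl)
    also have "\<dots> = kmat c p q r xs (u @ False # True # v) - kmat c p q r xs (u @ True # False # v)"
      unfolding xs by (rule kmat_swap[symmetric]) fact
    finally show ?thesis
      by (simp add: t kcol_def)
  next
    case False
    then show ?thesis
      by (simp add: t kinsert_def kcol_def kmat_length)
  qed
qed

text \<open>Replacing an adjacent \<open>01\<close> in \<open>y\<close> by \<open>10\<close> gives a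
  larger word. The error is the singlet tensored with a column of \<open>detshift c\<close> whose
  word has one match fewer; by induction on \<open>k\<close> that column lies in the span of larger
  ones, and inserting the singlet turns these into columns of \<open>c\<close> above
  \<open>y\<close>. For \<open>k = 0\<close> the kernel itself vanishes.\<close>

lemma straighten:
  fixes c :: "nat \<Rightarrow> nat \<Rightarrow> nat \<Rightarrow> 'a::field"
  assumes "(detshift ^^ k) c = (\<lambda>_ _ _. 0)" and "k \<le> matched 0 y"
  shows "kcol c y \<in> fs.span (kcol c ` {w. length w = length y \<and> binval y < binval w})"
  using assms
proof (induction k arbitrary: c y)
  case 0
  then have "kcol c y = 0"
    by (auto simp: kcol_def fun_eq_iff kmat_zero)
  then show ?case by (simp only: fs.span_zero)
next
  case (Suc k)
  let ?S = "kcol c ` {w. length w = length y \<and> binval y < binval w}"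
  obtain u v where y: "y = u @ False # True # v"
    using matched_no_adjacent[of y] Suc.prems(2) by (cases "matched 0 y = 0") auto
  have k: "k \<le> matched 0 (u @ v)"
    using Suc.prems(2) by (simp add: y matched_remove)
  have detshift: "(detshift ^^ k) (detshift c) = (\<lambda>_ _ _. 0)"
    using Suc.prems(1) by (simp add: funpow_swap1)
  let ?E = "kinsert (length u) (length u + length v + 2) :: _ \<Rightarrow> nat \<times> nat \<times> nat \<times> bool list \<Rightarrow> 'a"
  have E: "?E f \<in> fs.span ?S"
    if "f \<in> fs.span (kcol (detshift c) ` {w. length w = length (u @ v) \<and> binval (u @ v) < binval w})" for f
    using that
  proof (induction rule: fs.span_induct_alt)
    case base
    have "?E 0 = 0"
      by (auto simp: kinsert_def fun_eq_iff)
    then show ?case by (simp only: fs.span_zero)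
  next
    case (step a x z)
    then obtain w where w: "length w = length (u @ v)" "binval (u @ v) < binval w" "x = kcol (detshift c) w"
      by auto
    define u' v' where "u' = take (length u) w" and "v' = drop (length u) w"
    have w': "w = u' @ v'" "length u' = length u" "length v' = length v"
      using w(1) by (auto simp: u'_def v'_def)
    have "?E x = kcol c (u' @ False # True # v') - kcol c (u' @ True # False # v')"
      using kinsert_kcol[of u' v' c] w(3) w' by simp
    moreover have "kcol c (u' @ False # True # v') \<in> ?S"
      using w'(2,3) binval_insert[of u' u v' v "[False, True]" "[False, True]"] w(2) by (simp add: y w'(1))
    moreover have "kcol c (u' @ True # False # v') \<in> ?S"
      using w'(2,3) binval_insert[of u' u v' v "[True, False]" "[False, True]"] w(2) by (simp add: y w'(1))
    ultimately have "?E x \<in> fs.span ?S"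
      by (simp add: fs.span_base fs.span_diff)
    then show ?case
      unfolding kinsert_add kinsert_scale using step(2) by (intro fs.span_add fs.span_scale)
  qed
  have "kcol c y = ?E (kcol (detshift c) (u @ v)) + kcol c (u @ True # False # v)"
    unfolding kinsert_kcol y by (simp only: diff_add_cancel)
  moreover have "?E (kcol (detshift c) (u @ v)) \<in> fs.span ?S"
    using Suc.IH[OF detshift k] by (rule E)
  moreover have "kcol c (u @ True # False # v) \<in> ?S"
    by (auto simp: y binval_append)
  ultimately show ?case
    by (simp only: fs.span_add fs.span_base)
qed

definition few_matched :: "nat \<Rightarrow> nat \<Rightarrow> bool list set" where
  "few_matched k m = {w \<in> words m. matched 0 w < k}"

lemma finite_few_matched [simp]: "finite (few_matched k m)"
  by (simp add: few_matched_def)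

text \<open>Repeated straightening terminates because \<open>binval\<close> grows and stays below
  \<open>2 ^ m\<close>.\<close>

lemma kcol_in_span:
  fixes c :: "nat \<Rightarrow> nat \<Rightarrow> nat \<Rightarrow> 'a::field"
  assumes "(detshift ^^ k) c = (\<lambda>_ _ _. 0)" and "y \<in> words m"
  shows "kcol c y \<in> fs.span (kcol c ` few_matched k m)"
  using assms(2)
proof (induction "2 ^ m - binval y" arbitrary: y rule: less_induct)
  case less
  show ?case
  proof (cases "matched 0 y < k")
    case True
    then show ?thesis using less.prems by (auto simp: few_matched_def intro: fs.span_base)
  next
    case False
    have "kcol c ` {w. length w = length y \<and> binval y < binval w} \<subseteq> fs.span (kcol c ` few_matched k m)"
    proof clarify
      fix w assume "length w = length y" "binval y < binval w"
      moreover from this have "binval w < 2 ^ m"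
        using binval_less[of w] less.prems by (simp add: words_def)
      ultimately show "kcol c w \<in> fs.span (kcol c ` few_matched k m)"
        using less.prems by (intro less.hyps) (auto simp: words_def)
    qed
    then have "fs.span (kcol c ` {w. length w = length y \<and> binval y < binval w}) \<subseteq> fs.span (kcol c ` few_matched k m)"
      by (rule fs.span_minimal) (rule fs.subspace_span)
    then show ?thesis
      using straighten[OF assms(1), of y] False by auto
  qed
qed

lemma span_imageE:
  fixes f :: "'b \<Rightarrow> 'i \<Rightarrow> 'a::field"
  assumes "finite A" "x \<in> fs.span (f ` A)"
  obtains e where "\<And>t. x t = (\<Sum>a\<in>A. e a * f a t)"
proof -
  have "\<exists>e. \<forall>t. x t = (\<Sum>a\<in>A. e a * f a t)"
    using assms(2)
  proof (induction rule: fs.span_induct_alt)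
    case base
    then show ?case by (intro exI[of _ "\<lambda>_. 0"]) simp
  next
    case (step c x y)
    then obtain a0 e where a0: "a0 \<in> A" "x = f a0" and e: "\<forall>t. y t = (\<Sum>a\<in>A. e a * f a t)"
      by auto
    have "(\<Sum>a\<in>A. of_bool (a = a0) * c * f a t) = c * x t" for t
      using assms(1) a0 by (simp add: sum.remove[of A a0])
    then have "c * x t + y t = (\<Sum>a\<in>A. (of_bool (a = a0) * c + e a) * f a t)" for t
      using e by (simp add: distrib_right sum.distrib)
    then show ?case by (intro exI[of _ "\<lambda>a. of_bool (a = a0) * c + e a"]) simp
  qed
  with that show thesis by blast
qed

text \<open>The coefficients do not depend on the row, so this is a rank factorisation with one term
  per word with few matches.\<close>

lemma kmat_few_matched:
  fixes c :: "nat \<Rightarrow> nat \<Rightarrow> nat \<Rightarrow> 'a::field"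
  assumes "(detshift ^^ k) c = (\<lambda>_ _ _. 0)"
  obtains e where "\<And>x y. y \<in> words m \<Longrightarrow> kmat c 0 0 0 x y = (\<Sum>g\<in>few_matched k m. e y g * kmat c 0 0 0 x g)"
proof -
  have "\<exists>e. \<forall>x. kmat c 0 0 0 x y = (\<Sum>g\<in>few_matched k m. e g * kmat c 0 0 0 x g)" if "y \<in> words m" for y
  proof -
    from span_imageE[OF finite_few_matched kcol_in_span[OF assms that]]
    obtain e where e: "\<And>t. kcol c y t = (\<Sum>a\<in>few_matched k m. e a * kcol c a t)" by blast
    from e[of "(0, 0, 0, x)" for x] show ?thesis by (auto simp: kcol_def)
  qed
  with that show thesis by metis
qed

text \<open>The bound is linear in \<open>m\<close> for \<open>h = 0\<close> because closing parentheses are free there; the decay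
\<open>z\<^sup>h\<close> is what makes the induction close.\<close>

lemma sum_matched:
  fixes z :: real
  assumes "0 \<le> z" "z \<le> 1"
  shows "(\<Sum>w\<in>words m. z ^ matched h w) \<le> (1 + z) ^ m * (1 + real m * z ^ h)"
proof (induction m arbitrary: h)
  case (Suc m)
  show ?case
  proof (cases h)
    case 0
    have "(\<Sum>w\<in>words (Suc m). z ^ matched h w) \<le> (1 + z) ^ m * (1 + real m * z ^ 1) + (1 + z) ^ m * (1 + real m * z ^ 0)"
      using Suc.IH[of 1] Suc.IH[of 0] by (simp add: 0 sum_words_Suc)
    also have "\<dots> = (1 + z) ^ m * (2 + m * (1 + z))"
      by (simp add: algebra_simps)
    also have "\<dots> \<le> (1 + z) ^ m * ((1 + z) * (2 + m))"
      using assms by (intro mult_left_mono) (simp_all add: algebra_simps)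
    finally show ?thesis by (simp add: 0 algebra_simps)
  next
    case (Suc h')
    have "(\<Sum>w\<in>words (Suc m). z ^ matched h w)
        = (\<Sum>w\<in>words m. z ^ matched (Suc h) w) + z * (\<Sum>w\<in>words m. z ^ matched h' w)"
      by (simp add: Suc sum_words_Suc sum_distrib_left)
    also have "\<dots> \<le> (1 + z) ^ m * (1 + real m * z ^ Suc h) + z * ((1 + z) ^ m * (1 + real m * z ^ h'))"
      using assms by (intro add_mono mult_left_mono Suc.IH)
    also have "\<dots> = (1 + z) ^ Suc m * (1 + real m * z ^ h)"
      by (simp add: Suc algebra_simps)
    also have "\<dots> \<le> (1 + z) ^ Suc m * (1 + real (Suc m) * z ^ h)"
      using assms by (intro mult_left_mono) (simp_all add: algebra_simps)
    finally show ?thesis .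
  qed
qed simp

text \<open>Chernoff bound: a word with at most \<open>k\<close> matches has weight at least
  \<open>(1/8)^k\<close> in \<open>sum_matched\<close>. The cube \<open>1/8\<close> is convenient
  because later \<open>8 ^ (s div 3) \<le> 2 ^ s\<close>.\<close>

lemma card_few_matched: "real (card (few_matched (Suc k) m)) \<le> 8 ^ k * ((9/8) ^ m * (1 + real m))"
proof -
  have "real (card (few_matched (Suc k) m)) * (1/8) ^ k = (\<Sum>w\<in>few_matched (Suc k) m. (1/8::real) ^ k)"
    by simp
  also have "\<dots> \<le> (\<Sum>w\<in>few_matched (Suc k) m. (1/8) ^ matched 0 w)"
    by (intro sum_mono power_decreasing) (auto simp: few_matched_def)
  also have "\<dots> \<le> (\<Sum>w\<in>words m. (1/8) ^ matched 0 w)"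
    by (intro sum_mono2) (auto simp: few_matched_def)
  also have "\<dots> \<le> (9/8) ^ m * (1 + real m)"
    using sum_matched[of "1/8" 0 m] by simp
  finally show ?thesis by (simp add: field_simps power_divide)
qed

section \<open>Clifford matrices\<close>

fun odd_ones :: "bool list \<Rightarrow> bool" where
  "odd_ones [] = False"
| "odd_ones (b # w) = (b \<noteq> odd_ones w)"

fun dot :: "bool list \<Rightarrow> bool list \<Rightarrow> bool" where
  "dot (a # v) (b # w) = ((a \<and> b) \<noteq> dot v w)"
| "dot _ _ = False"

definition wxor :: "bool list \<Rightarrow> bool list \<Rightarrow> bool list" where
  "wxor = map2 (\<noteq>)"

lemma wxor_simps [simp]: "wxor [] w = []" "wxor (a # v) (b # w) = (a \<noteq> b) # wxor v w"
  by (simp_all add: wxor_def)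

lemma length_wxor [simp]: "length (wxor v w) = min (length v) (length w)"
  by (simp add: wxor_def)

lemma odd_ones_wxor: "length v = length w \<Longrightarrow> odd_ones (wxor v w) = (odd_ones v \<noteq> odd_ones w)"
  by (induction v w rule: list_induct2) auto

text \<open>The product, in increasing order, of the Jordan-Wigner generators selected by \<open>y\<close>,
conjugation by the diagonal parity operator being pushed into the leading qubits: each qubit
contributes \<open>X\<^sup>u W\<^sup>v Z\<^sup>e\<close>, where \<open>e\<close> is the parity of the remaining generators and \<open>W = X Z\<close>.\<close>

fun cliff :: "bool list \<Rightarrow> bool list \<Rightarrow> bool list \<Rightarrow> 'a::comm_ring_1" where
  "cliff (u # v # y) (p # P) (q # Q) =
     of_bool (p = (q \<noteq> (u \<noteq> v))) * bsign (q \<and> (v \<noteq> odd_ones y)) * cliff y P Q"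
| "cliff _ _ _ = 1"

lemma words_double_induct [consumes 1, case_names Nil Cons]:
  assumes "y \<in> words (2 * s)" "Q [] 0"
    and "\<And>u v y s. y \<in> words (2 * s) \<Longrightarrow> Q y s \<Longrightarrow> Q (u # v # y) (Suc s)"
  shows "Q y s"
  using assms(1)
proof (induction s arbitrary: y)
  case 0
  then show ?case using assms(2) by (simp add: words_def)
next
  case (Suc s)
  then obtain u v y' where "y = u # v # y'" "y' \<in> words (2 * s)"
    by (auto simp: words_def length_Suc_conv)
  then show ?case using assms(3) Suc.IH by simp
qed

lemma words_SucE:
  assumes "w \<in> words (Suc s)"
  obtains b v where "w = b # v" "v \<in> words s"
  using assms by (auto simp: words_def length_Suc_conv)

lemma bsign_xor: "bsign (a \<noteq> b) = (bsign a * bsign b :: 'a::comm_ring_1)"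
  by (simp add: bsign_def)

text \<open>Completeness relation of the \<open>4 ^ s\<close> Clifford matrices, proved one qubit at
  a time: the parity of the remaining generators only relabels the four choices of the leading
  pair.\<close>

lemma cliff_complete:
  assumes "p \<in> words s" "q \<in> words s" "p' \<in> words s" "q' \<in> words s"
  shows "(\<Sum>y\<in>words (2 * s). cliff y p q * cliff y p' q') = (of_bool (p = p' \<and> q = q') * 2 ^ s :: 'a::comm_ring_1)"
  using assms
proof (induction s arbitrary: p q p' q')
  case (Suc s)
  from Suc.prems obtain a P b Q a' P' b' Q' where
    e: "p = a # P" "q = b # Q" "p' = a' # P'" "q' = b' # Q'"
    and w: "P \<in> words s" "Q \<in> words s" "P' \<in> words s" "Q' \<in> words s"
    by (metis words_SucE)
  have "cliff (False # False # y) p q * cliff (False # False # y) p' q'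
      + cliff (False # True # y) p q * cliff (False # True # y) p' q'
      + cliff (True # False # y) p q * cliff (True # False # y) p' q'
      + cliff (True # True # y) p q * cliff (True # True # y) p' q'
      = of_bool (a = a' \<and> b = b') * 2 * (cliff y P Q * cliff y P' Q' :: 'a)" for y
    unfolding e by (cases a; cases b; cases a'; cases b'; cases "odd_ones y") simp_all
  then have "(\<Sum>y\<in>words (2 * Suc s). cliff y p q * cliff y p' q')
      = (\<Sum>y\<in>words (2 * s). of_bool (a = a' \<and> b = b') * 2 * (cliff y P Q * cliff y P' Q' :: 'a))"
    by (simp add: sum_words_Suc flip: sum.distrib) (simp add: add_ac)
  also have "\<dots> = of_bool (p = p' \<and> q = q') * 2 ^ Suc s"
    using Suc.IH[OF w] by (simp add: e flip: sum_distrib_left)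
  finally show ?case .
qed simp

text \<open>Every \<open>\<gamma>\<^sub>y\<close> is a signed permutation matrix, hence
  orthogonal.\<close>

lemma cliff_orth:
  assumes "y \<in> words (2 * s)" "p \<in> words s" "q \<in> words s"
  shows "(\<Sum>l\<in>words s. cliff y p l * cliff y q l) = (of_bool (p = q) :: 'a::comm_ring_1)"
  using assms
proof (induction y s arbitrary: p q rule: words_double_induct)
  case (Cons u v y s)
  from Cons.prems obtain a P b Q where e: "p = a # P" "q = b # Q" and w: "P \<in> words s" "Q \<in> words s"
    by (metis words_SucE)
  have "cliff (u # v # y) p (False # l) * cliff (u # v # y) q (False # l)
      + cliff (u # v # y) p (True # l) * cliff (u # v # y) q (True # l)
      = of_bool (a = b) * (cliff y P l * cliff y Q l :: 'a)" for l
    unfolding e by (cases a; cases b; cases u; cases v; cases "odd_ones y") simp_all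
  then show ?case
    using Cons.IH[OF w] by (simp add: sum_words_Suc e flip: sum.distrib sum_distrib_left)
qed simp

lemma cliff_zero:
  assumes "p \<in> words s" "q \<in> words s"
  shows "cliff (replicate (2 * s) False) p q = (of_bool (p = q) :: 'a::comm_ring_1)"
  using assms
proof (induction s arbitrary: p q)
  case (Suc s)
  have [simp]: "\<not> odd_ones (replicate m False)" for m
    by (induction m) auto
  from Suc.prems obtain a P b Q where "p = a # P" "q = b # Q" "P \<in> words s" "Q \<in> words s"
    by (metis words_SucE)
  with Suc.IH[of P Q] show ?case by simp
qed simp

definition cliff_prod :: "nat \<Rightarrow> bool list \<Rightarrow> bool list \<Rightarrow> bool list \<Rightarrow> bool list \<Rightarrow> 'a::comm_ring_1" where
  "cliff_prod s y y' p q = (\<Sum>l\<in>words s. cliff y p l * cliff y' l q)"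

lemma cliff_prod_Cons:
  "cliff_prod (Suc s) (u # v # y) (u' # v' # z) (a # P) (b # Q)
   = of_bool (a = (b \<noteq> ((u' \<noteq> v') \<noteq> (u \<noteq> v))))
     * bsign (((b \<noteq> (u' \<noteq> v')) \<and> (v \<noteq> odd_ones y)) \<noteq> (b \<and> (v' \<noteq> odd_ones z))) * (cliff_prod s y z P Q :: 'a::comm_ring_1)"
proof -
  \<comment> \<open>The leading qubit of the intermediate index is forced to this value, so one half
    of the sum vanishes.\<close>
  define c where "c = (b \<noteq> (u' \<noteq> v'))"
  have c: "(False = (b \<noteq> (u' \<noteq> v'))) = (\<not> c)" "(True = (b \<noteq> (u' \<noteq> v'))) = c"
    by (auto simp: c_def)
  have "cliff_prod (Suc s) (u # v # y) (u' # v' # z) (a # P) (b # Q)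
    = (\<Sum>l\<in>words s. of_bool (a = (c \<noteq> (u \<noteq> v))) * bsign (c \<and> (v \<noteq> odd_ones y)) * cliff y P l
        * (bsign (b \<and> (v' \<noteq> odd_ones z)) * (cliff z l Q :: 'a)))"
    unfolding cliff_prod_def sum_words_Suc cliff.simps c by (cases c) simp_all
  also have "\<dots> = of_bool (a = (c \<noteq> (u \<noteq> v))) * (bsign (c \<and> (v \<noteq> odd_ones y)) * bsign (b \<and> (v' \<noteq> odd_ones z)))
      * cliff_prod s y z P Q"
    by (simp only: cliff_prod_def sum_distrib_left mult_ac)
  also have "(a = (c \<noteq> (u \<noteq> v))) = (a = (b \<noteq> ((u' \<noteq> v') \<noteq> (u \<noteq> v))))"
    by (auto simp: c_def)
  finally show ?thesis
    by (simp only: bsign_xor c_def)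
qed

text \<open>Distinct generators anticommute, so the sign counts pairs of distinct generators,
  \<open>|y| |y'| - |y \<inter> y'|\<close> of them; \<open>dot\<close> is the parity of the
  intersection.\<close>

lemma cliff_prod_comm:
  assumes "y \<in> words (2 * s)" "y' \<in> words (2 * s)" "p \<in> words s" "q \<in> words s"
  shows "cliff_prod s y y' p q = (bsign (dot y y' \<noteq> (odd_ones y \<and> odd_ones y')) * cliff_prod s y' y p q :: 'a::comm_ring_1)"
  using assms
proof (induction y s arbitrary: y' p q rule: words_double_induct)
  case Nil
  then show ?case by (simp add: cliff_prod_def)
next
  case (Cons u v y s)
  from Cons.prems(1) obtain u' v' z where y': "y' = u' # v' # z" and z: "z \<in> words (2 * s)"
    by (auto simp: words_def length_Suc_conv)
  from Cons.prems(2,3) obtain a P b Q where e: "p = a # P" "q = b # Q" and w: "P \<in> words s" "Q \<in> words s"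
    by (metis words_SucE)
  have *: "cliff_prod (Suc s) (u # v # y) (u' # v' # z) p q
    = of_bool (a = (b \<noteq> ((u' \<noteq> v') \<noteq> (u \<noteq> v))))
      * bsign (((b \<noteq> (u' \<noteq> v')) \<and> (v \<noteq> odd_ones y)) \<noteq> (b \<and> (v' \<noteq> odd_ones z))) * (cliff_prod s y z P Q :: 'a)"
    for u v y u' v' z
    unfolding e by (rule cliff_prod_Cons)
  have b: "((((b \<noteq> (u' \<noteq> v')) \<and> (v \<noteq> odd_ones y)) \<noteq> (b \<and> (v' \<noteq> odd_ones z))) \<noteq> (dot y z \<noteq> (odd_ones y \<and> odd_ones z)))
    = ((dot (u # v # y) (u' # v' # z) \<noteq> (odd_ones (u # v # y) \<and> odd_ones (u' # v' # z)))
      \<noteq> (((b \<noteq> (u \<noteq> v)) \<and> (v' \<noteq> odd_ones z)) \<noteq> (b \<and> (v \<noteq> odd_ones y))))"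
    by (cases u; cases v; cases "odd_ones y"; cases u'; cases v'; cases "odd_ones z"; cases b) simp_all
  have c: "(a = (b \<noteq> ((u' \<noteq> v') \<noteq> (u \<noteq> v)))) = (a = (b \<noteq> ((u \<noteq> v) \<noteq> (u' \<noteq> v'))))"
    by blast
  have gen: "k1 = k2 * k3 \<Longrightarrow> k1 = x * y \<Longrightarrow> l * x * (y * g) = k2 * (l * k3 * g)" for k1 k2 k3 x y l g :: 'a
    by (metis mult.assoc mult.left_commute)
  show ?case
    unfolding y' * Cons.IH[OF z w] c
    by (rule gen[OF _ bsign_xor]) (unfold b, rule bsign_xor)
qed

text \<open>Common generators cancel up to sign. Only \<open>\<nu> * \<nu> = 1\<close> is recorded
  about the sign, which suffices because \<open>cliff_twist\<close> uses it squared.\<close>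

lemma cliff_prod_wxor:
  assumes "y \<in> words (2 * s)" "y' \<in> words (2 * s)"
  obtains \<nu> :: "'a::comm_ring_1" where "\<nu> * \<nu> = 1"
    "\<And>p q. p \<in> words s \<Longrightarrow> q \<in> words s \<Longrightarrow> cliff_prod s y y' p q = \<nu> * cliff (wxor y y') p q"
proof -
  have "\<exists>\<nu>::'a. \<nu> * \<nu> = 1 \<and>
    (\<forall>p\<in>words s. \<forall>q\<in>words s. cliff_prod s y y' p q = \<nu> * cliff (wxor y y') p q)"
    using assms
  proof (induction y s arbitrary: y' rule: words_double_induct)
    case Nil
    then show ?case by (intro exI[of _ 1]) (simp add: cliff_prod_def)
  next
    case (Cons u v y s)
    from Cons.prems(1) obtain u' v' z where y': "y' = u' # v' # z" and z: "z \<in> words (2 * s)"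
      by (auto simp: words_def length_Suc_conv)
    from Cons.IH[OF z] obtain \<nu> :: 'a where \<nu>: "\<nu> * \<nu> = 1"
      "\<forall>p\<in>words s. \<forall>q\<in>words s. cliff_prod s y z p q = \<nu> * cliff (wxor y z) p q"
      by blast
    \<comment> \<open>The sign from moving the \<open>Z\<close> power of the left factor past the
      flip of the right factor in the leading qubit.\<close>
    define \<mu> :: 'a where "\<mu> = bsign ((u' \<noteq> v') \<and> (v \<noteq> odd_ones y))"
    have odd_ones: "odd_ones (wxor y z) = (odd_ones y \<noteq> odd_ones z)"
      using Cons.hyps z by (intro odd_ones_wxor) (simp add: words_def)
    have "cliff_prod (Suc s) (u # v # y) y' (a # P) (b # Q) = \<mu> * \<nu> * cliff (wxor (u # v # y) y') (a # P) (b # Q)"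
      if "P \<in> words s" "Q \<in> words s" for a b P Q
    proof -
      have "cliff_prod (Suc s) (u # v # y) y' (a # P) (b # Q)
        = of_bool (a = (b \<noteq> ((u' \<noteq> v') \<noteq> (u \<noteq> v))))
          * bsign (((b \<noteq> (u' \<noteq> v')) \<and> (v \<noteq> odd_ones y)) \<noteq> (b \<and> (v' \<noteq> odd_ones z))) * (cliff_prod s y z P Q :: 'a)"
        unfolding y' by (rule cliff_prod_Cons)
      also have "cliff_prod s y z P Q = \<nu> * cliff (wxor y z) P Q"
        using \<nu> that by blast
      finally show ?thesis
        by (cases a; cases b; cases u; cases v; cases u'; cases v'; cases "odd_ones y"; cases "odd_ones z")
           (simp_all add: y' odd_ones \<mu>_def)
    qed
    moreover have "\<mu> * \<nu> * (\<mu> * \<nu>) = 1"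
      using \<nu>(1) by (simp add: \<mu>_def bsign_def)
    ultimately show ?case
      by (intro exI[of _ "\<mu> * \<nu>"]) (auto simp: words_Suc)
  qed
  with that show thesis by blast
qed

section \<open>Transposes of Clifford matrices\<close>

fun ones :: "bool list \<Rightarrow> nat" where
  "ones [] = 0"
| "ones (b # w) = of_bool b + ones w"

lemma odd_ones_iff: "odd_ones w = odd (ones w)"
  by (induction w) auto

text \<open>The character counting, modulo 2, the generators of type \<open>W\<close>, which are the
  antisymmetric ones.\<close>

fun msign :: "bool list \<Rightarrow> 'a::comm_ring_1" where
  "msign (u # v # y) = bsign v * msign y"
| "msign _ = 1"

lemma msign_wxor:
  assumes "y \<in> words (2 * s)" "y' \<in> words (2 * s)"
  shows "msign (wxor y y') = (msign y * msign y' :: 'a::comm_ring_1)"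
  using assms
proof (induction y s arbitrary: y' rule: words_double_induct)
  case (Cons u v y s)
  from Cons.prems obtain u' v' z where y': "y' = u' # v' # z" and z: "z \<in> words (2 * s)"
    by (auto simp: words_def length_Suc_conv)
  from Cons.IH[OF z] show ?case by (cases v; cases v') (simp_all add: y')
qed (simp add: words_def)

text \<open>Transposition reverses a product of \<open>l = ones y\<close> generators, at the cost of
  \<open>(-1)^(l(l-1)/2)\<close>, an exponent with the parity of \<open>l div 2\<close>; it also
  negates each antisymmetric generator, which \<open>msign\<close> records.\<close>

lemma cliff_transpose:
  assumes "y \<in> words (2 * s)" "p \<in> words s" "q \<in> words s"
  shows "cliff y p q = (msign y * bsign (odd (ones y div 2)) * cliff y q p :: 'a::comm_ring_1)"
  using assms
proof (induction y s arbitrary: p q rule: words_double_induct)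
  case (Cons u v y s)
  from Cons.prems obtain a P b Q where e: "p = a # P" "q = b # Q" and w: "P \<in> words s" "Q \<in> words s"
    by (metis words_SucE)
  have c: "odd (Suc (ones y) div 2) = (odd (ones y div 2) \<noteq> odd_ones y)"
    "odd (Suc (Suc (ones y)) div 2) = (\<not> odd (ones y div 2))"
    by (simp_all add: odd_ones_iff) presburger
  show ?case
    unfolding e cliff.simps Cons.IH[OF w]
    by (cases u; cases v; cases a; cases b; cases "odd_ones y"; cases "odd (ones y div 2)")
       (simp_all add: c del: even_Suc_div_two)
qed simp

section \<open>Tensors and their cuts\<close>

text \<open>Disjoint sets \<open>A, B\<close> are read as the word with \<open>X\<close> on
  \<open>A\<close>, \<open>Z\<close> on \<open>B\<close> and \<open>1\<close> elsewhere, to match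
  the words behind \<open>kmat\<close>.\<close>

fun letter_weight :: "(nat \<Rightarrow> nat \<Rightarrow> nat \<Rightarrow> 'a::comm_ring_1) \<Rightarrow> nat \<Rightarrow> nat \<Rightarrow> nat \<Rightarrow> bool list \<Rightarrow> bool list \<Rightarrow> 'a" where
  "letter_weight c p q r [] [] = c p q r"
| "letter_weight c p q r (a # A) (b # B) =
     (if a then if b then 0 else letter_weight c p (Suc q) r A B
      else if b then letter_weight c p q (Suc r) A B else letter_weight c (Suc p) q r A B)"
| "letter_weight c p q r _ _ = 0"

lemma bsign_not: "bsign (\<not> b) = (- bsign b :: 'a::comm_ring_1)"
  by (simp add: bsign_def)

text \<open>In row \<open>x\<close> and column \<open>y\<close> only words whose flips sit exactly
  where \<open>x\<close> and \<open>y\<close> differ contribute, and \<open>Z\<close> on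
  \<open>B\<close> contributes the sign given by \<open>dot B y\<close>.\<close>

lemma sum_letter_weight:
  "length x = length y \<Longrightarrow>
    (\<Sum>B\<in>words (length y). letter_weight c p q r (wxor x y) B * bsign (dot B y)) = kmat c p q r x y"
proof (induction x y arbitrary: p q r rule: list_induct2)
  case (Cons a x b y)
  show ?case
    using Cons.IH[of "Suc p" q r] Cons.IH[of p "Suc q" r] Cons.IH[of p q "Suc r"]
    by (cases a; cases b) (simp_all add: sum_words_Suc bsign_not sum_negf)
qed simp

text \<open>Starting from counts zero this forces \<open>A\<close> and \<open>B\<close> to be even.
  Then \<open>\<gamma>\<^sub>A\<close> and \<open>\<gamma>\<^sub>B\<close> commute for disjoint
  \<open>A, B\<close>, and conjugation by \<open>\<gamma>\<^sub>B\<close> is a pure sign.\<close>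

definition even_kernel :: "(nat \<Rightarrow> nat \<Rightarrow> nat \<Rightarrow> 'a::comm_ring_1) \<Rightarrow> bool" where
  "even_kernel c \<longleftrightarrow> (\<forall>p q r. c p q r \<noteq> 0 \<longrightarrow> even q \<and> even r)"

lemma letter_weight_even:
  assumes "even_kernel c"
  shows "letter_weight c p q r A B \<noteq> 0 \<Longrightarrow> (even q = even (ones A)) \<and> (even r = even (ones B))"
  using assms
proof (induction c p q r A B rule: letter_weight.induct)
  case (1 c p q r)
  then show ?case by (auto simp: even_kernel_def)
qed (auto split: if_splits)

lemma letter_weight_disjoint: "letter_weight c p q r A B \<noteq> 0 \<Longrightarrow> \<not> dot A B"
  by (induction c p q r A B rule: letter_weight.induct) (auto split: if_splits)

text \<open>The part of the transposition sign of \<open>\<gamma>\<^sub>A\<close> that depends on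
  \<open>|A| = q\<close>. For even \<open>q\<close> it replaces the square \<open>b\<close> of the
  letter \<open>X\<close> by \<open>- b\<close>, turning the form \<open>a - b - c\<close> into
  \<open>a + b - c\<close>.\<close>

definition flip_sign :: "(nat \<Rightarrow> nat \<Rightarrow> nat \<Rightarrow> 'a::comm_ring_1) \<Rightarrow> nat \<Rightarrow> nat \<Rightarrow> nat \<Rightarrow> 'a" where
  "flip_sign c p q r = bsign (odd (q div 2)) * c p q r"

definition swap_letters :: "(nat \<Rightarrow> nat \<Rightarrow> nat \<Rightarrow> 'a) \<Rightarrow> nat \<Rightarrow> nat \<Rightarrow> nat \<Rightarrow> 'a" where
  "swap_letters c p q r = c p r q"

lemma letter_weight_flip: "letter_weight (flip_sign c) p q r A B = bsign (odd ((q + ones A) div 2)) * letter_weight c p q r A B"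
  by (induction c p q r A B rule: letter_weight.induct) (auto simp: flip_sign_def)

lemma letter_weight_swap: "letter_weight (swap_letters c) p q r B A = letter_weight c p r q A B"
  by (induction "swap_letters c" p q r B A rule: letter_weight.induct) (auto simp: swap_letters_def)

lemma letter_weight_sum: "letter_weight (\<lambda>p q r. \<Sum>x\<in>X. c x p q r) p q r A B = (\<Sum>x\<in>X. letter_weight (c x) p q r A B)"
  by (induction "\<lambda>p q r. \<Sum>x\<in>X. c x p q r" p q r A B rule: letter_weight.induct) auto

lemma letter_weight_unit:
  assumes "\<And>p' q' r'. p' + q' + r' = p + q + r + length A \<Longrightarrow> c p' q' r' = of_bool (q' = 0 \<and> r' = 0)"
    and "length A = length B"
  shows "letter_weight c p q r A B = of_bool (q + ones A = 0 \<and> r + ones B = 0)"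
  using assms(2,1)
proof (induction A B arbitrary: p q r rule: list_induct2)
  case (Cons a A b B)
  have "letter_weight c (p + (if \<not> a \<and> \<not> b then 1 else 0)) (q + of_bool a) (r + of_bool b) A B
    = of_bool (q + of_bool a + ones A = 0 \<and> r + of_bool b + ones B = 0)" if "\<not> (a \<and> b)"
    using that by (intro Cons.IH Cons.prems) auto
  then show ?case by (cases a; cases b) simp_all
qed simp

lemma ones_0: "ones A = 0 \<Longrightarrow> A = replicate (length A) False"
  by (induction A) (auto split: if_splits)

lemma ones_replicate [simp]: "ones (replicate n False) = 0"
  by (induction n) auto

lemma wxor_cancel: "length x = length y \<Longrightarrow> wxor (wxor x y) y = x"
  by (induction x y rule: list_induct2) auto

section \<open>Conjugation identities and the Bell basis\<close>

lemma cliff_prod_assoc: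
  "(\<Sum>q\<in>words s. cliff_prod s A B p q * cliff y q r) = (\<Sum>l\<in>words s. cliff A p l * cliff_prod s B y l r)"
proof -
  have "(\<Sum>q\<in>words s. cliff_prod s A B p q * cliff y q r)
      = (\<Sum>q\<in>words s. \<Sum>l\<in>words s. cliff A p l * (cliff B l q * cliff y q r))"
    by (simp add: cliff_prod_def sum_distrib_right mult.assoc)
  also have "\<dots> = (\<Sum>l\<in>words s. \<Sum>q\<in>words s. cliff A p l * (cliff B l q * cliff y q r))"
    by (rule sum.swap)
  finally show ?thesis by (simp add: cliff_prod_def sum_distrib_left)
qed

lemma cliff_prod_cancel:
  assumes "B \<in> words (2 * s)" "i \<in> words s"
  shows "(\<Sum>r\<in>words s. cliff_prod s y B l r * cliff B i r) = cliff y l i"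
proof -
  have "(\<Sum>r\<in>words s. cliff_prod s y B l r * cliff B i r)
      = (\<Sum>r\<in>words s. \<Sum>m\<in>words s. cliff y l m * (cliff B m r * cliff B i r))"
    by (simp add: cliff_prod_def sum_distrib_right mult.assoc)
  also have "\<dots> = (\<Sum>m\<in>words s. \<Sum>r\<in>words s. cliff y l m * (cliff B m r * cliff B i r))"
    by (rule sum.swap)
  also have "\<dots> = (\<Sum>m\<in>words s. cliff y l m * of_bool (m = i))"
    using assms by (simp add: cliff_orth flip: sum_distrib_left)
  also have "\<dots> = cliff y l i"
    using assms(2) by (simp add: sum.remove[of _ i])
  finally show ?thesis .
qed

text \<open>The left side is an entry of
  \<open>\<gamma>\<^sub>A \<gamma>\<^sub>B \<gamma>\<^sub>y\<close> times the transpose of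
  \<open>\<gamma>\<^sub>B\<close>. As \<open>B\<close> is even, \<open>\<gamma>\<^sub>B\<close>
  passes \<open>\<gamma>\<^sub>y\<close> with the sign of \<open>dot B y\<close> and then cancels by
  orthogonality.\<close>

lemma cliff_conjugate:
  assumes "B \<in> words (2 * s)" "y \<in> words (2 * s)" "i \<in> words s" "\<not> odd_ones B"
  shows "(\<Sum>q\<in>words s. \<Sum>r\<in>words s. cliff_prod s A B p q * cliff y q r * cliff B i r)
      = bsign (dot B y) * cliff_prod s A y p i"
proof -
  have "(\<Sum>q\<in>words s. \<Sum>r\<in>words s. cliff_prod s A B p q * cliff y q r * cliff B i r)
      = (\<Sum>r\<in>words s. (\<Sum>q\<in>words s. cliff_prod s A B p q * cliff y q r) * cliff B i r)"
    by (subst sum.swap) (simp add: sum_distrib_right)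
  also have "\<dots> = (\<Sum>r\<in>words s. \<Sum>l\<in>words s. cliff A p l * (cliff_prod s B y l r * cliff B i r))"
    by (simp add: cliff_prod_assoc sum_distrib_right mult.assoc)
  also have "\<dots> = (\<Sum>l\<in>words s. \<Sum>r\<in>words s. cliff A p l * (cliff_prod s B y l r * cliff B i r))"
    by (rule sum.swap)
  also have "\<dots> = (\<Sum>l\<in>words s. cliff A p l * (bsign (dot B y) * (\<Sum>r\<in>words s. cliff_prod s y B l r * cliff B i r)))"
    using assms by (simp add: cliff_prod_comm[of B s y] sum_distrib_left mult.assoc)
  also have "\<dots> = bsign (dot B y) * cliff_prod s A y p i"
    using assms by (simp add: cliff_prod_cancel) (simp add: cliff_prod_def sum_distrib_left mult_ac)
  finally show ?thesis .
qed

text \<open>For \<open>x = wxor A y\<close>, the same sign relates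
  \<open>\<gamma>\<^sub>A \<gamma>\<^sub>y\<close> to \<open>\<gamma>\<^sub>x\<close> and
  \<open>\<gamma>\<^sub>A\<close> to \<open>\<gamma>\<^sub>x\<close> times the transpose of
  \<open>\<gamma>\<^sub>y\<close>, so it drops out of the product.\<close>

lemma cliff_twist:
  assumes "A \<in> words (2 * s)" "y \<in> words (2 * s)"
    and "a \<in> words s" "b \<in> words s" "i \<in> words s" "j \<in> words s"
  shows "cliff A a b * cliff_prod s A y i j
    = (\<Sum>l\<in>words s. cliff (wxor A y) a l * cliff y b l) * (cliff (wxor A y) i j :: 'a::comm_ring_1)"
proof -
  obtain \<nu> :: 'a where \<nu>: "\<nu> * \<nu> = 1"
    "\<And>p q. p \<in> words s \<Longrightarrow> q \<in> words s \<Longrightarrow> cliff_prod s A y p q = \<nu> * cliff (wxor A y) p q"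
    by (rule cliff_prod_wxor[OF assms(1,2)]) blast
  have "cliff A a b = (\<Sum>l\<in>words s. cliff_prod s A y a l * cliff y b l)"
    by (rule cliff_prod_cancel[OF assms(2,4), symmetric])
  also have "\<dots> = \<nu> * (\<Sum>l\<in>words s. cliff (wxor A y) a l * cliff y b l)"
    using assms \<nu>(2) by (simp add: sum_distrib_left mult.assoc)
  finally show ?thesis
    using \<nu> assms by (simp add: mult_ac) (metis (no_types, lifting) mult.assoc mult_1)
qed

text \<open>The last two columns are expanded in the basis of all \<open>\<gamma>\<^sub>y\<close>, on which \<open>\<gamma>\<^sub>B\<close> acts by conjugation
as a sign; the cocycle of the products cancels between the first and the second factor.\<close>

lemma bell_expand:
  fixes W :: "bool list \<Rightarrow> bool list \<Rightarrow> 'a::comm_ring_1"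
  assumes W: "\<And>A B. W A B \<noteq> 0 \<Longrightarrow> \<not> odd_ones B"
    and w: "a \<in> words s" "b \<in> words s" "i2 \<in> words s" "i3 \<in> words s" "j2 \<in> words s" "j3 \<in> words s"
  shows "2 ^ s * (\<Sum>A\<in>words (2*s). \<Sum>B\<in>words (2*s). W A B * cliff A a b * cliff_prod s A B i2 j2 * cliff B i3 j3)
    = (\<Sum>y\<in>words (2*s). \<Sum>x\<in>words (2*s). (\<Sum>B\<in>words (2*s). W (wxor x y) B * bsign (dot B y))
        * (\<Sum>l\<in>words s. cliff x a l * cliff y b l) * cliff x i2 i3 * cliff y j2 j3)"
proof -
  let ?W = "words (2*s)" and ?w = "words s"
  \<comment> \<open>Inserting the completeness relation separates the indices \<open>i2, i3\<close>
    from \<open>j2, j3\<close>.\<close>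
  have fourier: "2 ^ s * (cliff_prod s A B i2 j2 * cliff B i3 j3)
      = (\<Sum>y\<in>?W. bsign (dot B y) * cliff_prod s A y i2 i3 * cliff y j2 j3 :: 'a)"
    if "B \<in> ?W" "\<not> odd_ones B" for A B
  proof -
    have "(\<Sum>y\<in>?W. bsign (dot B y) * cliff_prod s A y i2 i3 * cliff y j2 j3 :: 'a)
      = (\<Sum>y\<in>?W. \<Sum>q\<in>?w. \<Sum>r\<in>?w. cliff_prod s A B i2 q * cliff B i3 r * (cliff y q r * cliff y j2 j3))"
      using that w by (simp add: cliff_conjugate[symmetric]) (simp add: sum_distrib_right sum_distrib_left mult_ac)
    also have "\<dots> = (\<Sum>q\<in>?w. \<Sum>r\<in>?w. \<Sum>y\<in>?W. cliff_prod s A B i2 q * cliff B i3 r * (cliff y q r * cliff y j2 j3))"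
      by (simp only: sum.swap[of _ ?w ?W])
    also have "\<dots> = (\<Sum>q\<in>?w. \<Sum>r\<in>?w. cliff_prod s A B i2 q * cliff B i3 r * (of_bool (q = j2 \<and> r = j3) * 2 ^ s))"
      using w by (simp add: cliff_complete flip: sum_distrib_left)
    also have "\<dots> = (\<Sum>q\<in>?w. of_bool (q = j2) * (cliff_prod s A B i2 q * (\<Sum>r\<in>?w. of_bool (r = j3) * (cliff B i3 r * 2 ^ s))))"
      by (simp only: sum_distrib_left of_bool_conj mult_ac)
    also have "\<dots> = cliff_prod s A B i2 j2 * (cliff B i3 j3 * 2 ^ s)"
      using w by (simp add: sum.remove[of _ j2] sum.remove[of _ j3])
    finally show ?thesis by (simp add: mult_ac)
  qed
  have "2 ^ s * (\<Sum>A\<in>?W. \<Sum>B\<in>?W. W A B * cliff A a b * cliff_prod s A B i2 j2 * cliff B i3 j3)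
      = (\<Sum>A\<in>?W. \<Sum>B\<in>?W. W A B * cliff A a b * (2 ^ s * (cliff_prod s A B i2 j2 * cliff B i3 j3)))"
    by (simp add: sum_distrib_left mult_ac)
  also have "\<dots> = (\<Sum>A\<in>?W. \<Sum>B\<in>?W. \<Sum>y\<in>?W. W A B * cliff A a b * (bsign (dot B y) * cliff_prod s A y i2 i3 * cliff y j2 j3))"
  proof (intro sum.cong refl)
    fix A B assume "A \<in> ?W" "B \<in> ?W"
    then show "W A B * cliff A a b * (2 ^ s * (cliff_prod s A B i2 j2 * cliff B i3 j3))
      = (\<Sum>y\<in>?W. W A B * cliff A a b * (bsign (dot B y) * cliff_prod s A y i2 i3 * cliff y j2 j3))"
      using W[of A B] fourier[of B A] by (cases "W A B = 0") (simp_all add: sum_distrib_left)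
  qed
  also have "\<dots> = (\<Sum>A\<in>?W. \<Sum>y\<in>?W. \<Sum>B\<in>?W. W A B * cliff A a b * (bsign (dot B y) * cliff_prod s A y i2 i3 * cliff y j2 j3))"
    by (rule sum.cong[OF refl], rule sum.swap)
  also have "\<dots> = (\<Sum>y\<in>?W. \<Sum>A\<in>?W. \<Sum>B\<in>?W. W A B * cliff A a b * (bsign (dot B y) * cliff_prod s A y i2 i3 * cliff y j2 j3))"
    by (rule sum.swap)
  also have "\<dots> = (\<Sum>y\<in>?W. \<Sum>A\<in>?W. (\<Sum>B\<in>?W. W A B * bsign (dot B y)) * (cliff A a b * cliff_prod s A y i2 i3) * cliff y j2 j3)"
    by (simp add: sum_distrib_left sum_distrib_right mult_ac)
  also have "\<dots> = (\<Sum>y\<in>?W. \<Sum>A\<in>?W. (\<Sum>B\<in>?W. W A B * bsign (dot B y))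
        * (\<Sum>l\<in>?w. cliff (wxor A y) a l * cliff y b l) * cliff (wxor A y) i2 i3 * cliff y j2 j3)"
    using w by (simp add: cliff_twist mult.assoc)
  also have "\<dots> = (\<Sum>y\<in>?W. \<Sum>x\<in>?W. (\<Sum>B\<in>?W. W (wxor x y) B * bsign (dot B y))
        * (\<Sum>l\<in>?w. cliff x a l * cliff y b l) * cliff x i2 i3 * cliff y j2 j3)"
  proof (rule sum.cong[OF refl])
    fix y assume "y \<in> ?W"
    then show "(\<Sum>A\<in>?W. (\<Sum>B\<in>?W. W A B * bsign (dot B y))
        * (\<Sum>l\<in>?w. cliff (wxor A y) a l * cliff y b l) * cliff (wxor A y) i2 i3 * cliff y j2 j3)
      = (\<Sum>x\<in>?W. (\<Sum>B\<in>?W. W (wxor x y) B * bsign (dot B y))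
        * (\<Sum>l\<in>?w. cliff x a l * cliff y b l) * cliff x i2 i3 * cliff y j2 j3)"
      by (intro sum.reindex_bij_witness[where i = "\<lambda>x. wxor x y" and j = "\<lambda>x. wxor x y"])
         (auto simp: words_def wxor_cancel)
  qed
  finally show ?thesis .
qed

definition cliff_tensor where
  "cliff_tensor s c i1 i2 i3 j1 j2 j3 = (\<Sum>A\<in>words (2*s). \<Sum>B\<in>words (2*s).
     letter_weight c 0 0 0 A B * cliff A i1 j1 * cliff_prod s A B i2 j2 * cliff B i3 j3)"

text \<open>All row indices go with \<open>x\<close> and all column indices with \<open>y\<close>:
  after a change of basis the tensor is \<open>kmat c\<close> tensored with the identity on
  \<open>l\<close>.\<close>

lemma cliff_tensor_cut0:
  assumes "even_kernel c"
    and "i1 \<in> words s" "i2 \<in> words s" "i3 \<in> words s" "j1 \<in> words s" "j2 \<in> words s" "j3 \<in> words s"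
  shows "2 ^ s * cliff_tensor s c i1 i2 i3 j1 j2 j3 = (\<Sum>y\<in>words (2*s). \<Sum>x\<in>words (2*s). kmat c 0 0 0 x y
        * (\<Sum>l\<in>words s. cliff x i1 l * cliff y j1 l) * cliff x i2 i3 * cliff y j2 j3)"
proof -
  have "\<not> odd_ones B" if "letter_weight c 0 0 0 A B \<noteq> 0" for A B
    using letter_weight_even[OF assms(1) that] by (simp add: odd_ones_iff)
  moreover have "(\<Sum>B\<in>words (2*s). letter_weight c 0 0 0 (wxor x y) B * bsign (dot B y)) = kmat c 0 0 0 x y"
    if "x \<in> words (2*s)" "y \<in> words (2*s)" for x y
    using sum_letter_weight[of x y c 0 0 0] that by (simp add: words_def)
  ultimately show ?thesis
    unfolding cliff_tensor_def using assms
    by (subst bell_expand) auto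
qed

text \<open>Since \<open>\<gamma>\<^sub>A\<close> is symmetric up to the sign \<open>(-1)\<^bsup>|A|/2\<^esup>\<close> and a character of \<open>A\<close>, transposing the
first factor merely changes the coefficients.\<close>

lemma cliff_tensor_cut1:
  assumes "even_kernel c"
    and "i1 \<in> words s" "i2 \<in> words s" "i3 \<in> words s" "j1 \<in> words s" "j2 \<in> words s" "j3 \<in> words s"
  shows "2 ^ s * cliff_tensor s c i1 i2 i3 j1 j2 j3 = (\<Sum>y\<in>words (2*s). \<Sum>x\<in>words (2*s). (msign x * msign y * kmat (flip_sign c) 0 0 0 x y)
        * (\<Sum>l\<in>words s. cliff x j1 l * cliff y i1 l) * cliff x i2 i3 * cliff y j2 j3)"
proof -
  define W where "W A B = msign A * letter_weight (flip_sign c) 0 0 0 A B" for A B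
  have W: "\<not> odd_ones B" if "W A B \<noteq> 0" for A B
    using letter_weight_even[OF assms(1), of 0 0 0 A B] that
    by (cases "letter_weight c 0 0 0 A B = 0") (auto simp: odd_ones_iff W_def letter_weight_flip)
  have WK: "(\<Sum>B\<in>words (2*s). W (wxor x y) B * bsign (dot B y)) = msign x * msign y * kmat (flip_sign c) 0 0 0 x y"
    if "x \<in> words (2*s)" "y \<in> words (2*s)" for x y
    using sum_letter_weight[of x y "flip_sign c" 0 0 0] that
    by (simp add: words_def W_def msign_wxor[OF that] mult.assoc flip: sum_distrib_left)
  have "cliff_tensor s c i1 i2 i3 j1 j2 j3 = (\<Sum>A\<in>words (2*s). \<Sum>B\<in>words (2*s).
     W A B * cliff A j1 i1 * cliff_prod s A B i2 j2 * cliff B i3 j3)"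
    unfolding cliff_tensor_def
    by (intro sum.cong refl, subst cliff_transpose) (use assms in \<open>auto simp: W_def letter_weight_flip\<close>)
  then show ?thesis
    using assms by (simp add: bell_expand[OF W] WK cong: sum.cong)
qed

text \<open>As \<open>\<gamma>\<^sub>A\<close> and \<open>\<gamma>\<^sub>B\<close> commute in the
  middle factor, exchanging the outer factors only exchanges the two letters. This reduces the third
  cut to the second.\<close>

lemma cliff_tensor_reverse:
  fixes c :: "nat \<Rightarrow> nat \<Rightarrow> nat \<Rightarrow> 'a::comm_ring_1"
  assumes "even_kernel c" "i2 \<in> words s" "j2 \<in> words s"
  shows "cliff_tensor s c i1 i2 i3 j1 j2 j3 = cliff_tensor s (swap_letters c) i3 i2 i1 j3 j2 j1"
proof -
  have *: "letter_weight c 0 0 0 A B * cliff_prod s A B i2 j2 = letter_weight c 0 0 0 A B * cliff_prod s B A i2 j2"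
    if "A \<in> words (2*s)" "B \<in> words (2*s)" for A B
    using letter_weight_even[OF assms(1), of 0 0 0 A B] letter_weight_disjoint[of c 0 0 0 A B] cliff_prod_comm[OF that assms(2,3), where 'a = 'a]
    by (cases "letter_weight c 0 0 0 A B = 0") (auto simp: odd_ones_iff)
  have "cliff_tensor s c i1 i2 i3 j1 j2 j3 = (\<Sum>A\<in>words (2*s). \<Sum>B\<in>words (2*s).
     (letter_weight c 0 0 0 A B * cliff_prod s A B i2 j2) * (cliff A i1 j1 * cliff B i3 j3))"
    by (simp add: cliff_tensor_def mult_ac)
  also have "\<dots> = (\<Sum>A\<in>words (2*s). \<Sum>B\<in>words (2*s).
     (letter_weight c 0 0 0 A B * cliff_prod s B A i2 j2) * (cliff A i1 j1 * cliff B i3 j3))"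
    by (intro sum.cong refl arg_cong2[where f = "(*)"] *)
  also have "\<dots> = (\<Sum>B\<in>words (2*s). \<Sum>A\<in>words (2*s).
     (letter_weight c 0 0 0 A B * cliff_prod s B A i2 j2) * (cliff A i1 j1 * cliff B i3 j3))"
    by (rule sum.swap)
  finally show ?thesis
    by (simp add: cliff_tensor_def letter_weight_swap mult_ac)
qed

lemma cliff_tensor_unit:
  assumes "\<And>p q r. p + q + r = 2 * s \<Longrightarrow> c p q r = of_bool (q = 0 \<and> r = 0)"
    and w: "i1 \<in> words s" "i2 \<in> words s" "i3 \<in> words s" "j1 \<in> words s" "j2 \<in> words s" "j3 \<in> words s"
  shows "cliff_tensor s c i1 i2 i3 j1 j2 j3 = of_bool (i1 = j1 \<and> i2 = j2 \<and> i3 = j3)"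
proof -
  define e where "e = replicate (2 * s) False"
  have e: "e \<in> words (2*s)" "ones e = 0" by (simp_all add: e_def words_def)
  have "letter_weight c 0 0 0 A B = of_bool (A = e) * of_bool (B = e)" if "A \<in> words (2*s)" "B \<in> words (2*s)" for A B
  proof -
    have len: "length A = 2 * s" "length B = 2 * s"
      using that by (simp_all add: words_def)
    have "letter_weight c 0 0 0 A B = of_bool (0 + ones A = 0 \<and> 0 + ones B = 0)"
      by (rule letter_weight_unit) (simp_all add: assms(1) len)
    moreover have "ones A = 0 \<longleftrightarrow> A = e" "ones B = 0 \<longleftrightarrow> B = e"
      using ones_0[of A] ones_0[of B] len e(2) by (auto simp: e_def)
    ultimately show ?thesis by (simp add: of_bool_conj)
  qed
  then have "cliff_tensor s c i1 i2 i3 j1 j2 j3 = (\<Sum>A\<in>words (2*s). \<Sum>B\<in>words (2*s).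
     of_bool (A = e) * of_bool (B = e) * cliff A i1 j1 * cliff_prod s A B i2 j2 * cliff B i3 j3)"
    unfolding cliff_tensor_def by (intro sum.cong refl) (simp only:)
  also have "\<dots> = (\<Sum>A\<in>words (2*s). of_bool (A = e) * (\<Sum>B\<in>words (2*s).
     of_bool (B = e) * (cliff A i1 j1 * cliff_prod s A B i2 j2 * cliff B i3 j3)))"
    by (simp only: sum_distrib_left mult_ac)
  also have "\<dots> = cliff e i1 j1 * cliff_prod s e e i2 j2 * cliff e i3 j3"
    using e(1) by (simp add: sum.remove[of _ e])
  also have "cliff_prod s e e i2 j2 = of_bool (i2 = j2)"
  proof -
    have "cliff_prod s e e i2 j2 = (\<Sum>l\<in>words s. of_bool (l = i2) * cliff e l j2)"
      using w by (auto simp: cliff_prod_def e_def cliff_zero intro!: sum.cong)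
    also have "\<dots> = of_bool (i2 = j2)"
      using w by (simp add: sum.remove[of _ i2] e_def cliff_zero)
    finally show ?thesis .
  qed
  finally show ?thesis
    using w by (auto simp: e_def cliff_zero)
qed

lemma cliff_tensor_sum: "cliff_tensor s (\<lambda>p q r. \<Sum>x\<in>X. c x p q r) i1 i2 i3 j1 j2 j3 = (\<Sum>x\<in>X. cliff_tensor s (c x) i1 i2 i3 j1 j2 j3)"
  unfolding cliff_tensor_def letter_weight_sum sum_distrib_right
  by (simp only: sum.swap[of _ X])

text \<open>The factorisation of \<open>kmat\<close> is placed between the changes of basis; a term
  is an index \<open>l\<close> of the identity and a word with few matches. The diagonal weight
  \<open>w\<close> absorbs \<open>msign\<close> without adding terms.\<close>

lemma kmat_factor:
  fixes c :: "nat \<Rightarrow> nat \<Rightarrow> nat \<Rightarrow> 'a::field"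
  assumes "(detshift ^^ k) c = (\<lambda>_ _ _. 0)"
  obtains U V :: "bool list \<times> bool list \<Rightarrow> bool list \<Rightarrow> bool list \<Rightarrow> bool list \<Rightarrow> 'a" where
    "\<And>a b i2 i3 j2 j3. (\<Sum>y\<in>words (2*s). \<Sum>x\<in>words (2*s). (w x * w y * kmat c 0 0 0 x y)
        * (\<Sum>l\<in>words s. cliff x a l * cliff y b l) * cliff x i2 i3 * cliff y j2 j3)
      = (\<Sum>h\<in>words s \<times> few_matched k (2*s). U h a i2 i3 * V h b j2 j3)"
proof -
  let ?W = "words (2*s)" and ?w = "words s" and ?G = "few_matched k (2*s)"
  obtain e where e: "\<And>x y. y \<in> ?W \<Longrightarrow> kmat c 0 0 0 x y = (\<Sum>g\<in>?G. e y g * kmat c 0 0 0 x g)"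
    using kmat_few_matched[OF assms, of "2*s"] by blast
  define U where "U = (\<lambda>(l, g) a i2 i3. \<Sum>x\<in>?W. w x * kmat c 0 0 0 x g * cliff x a l * cliff x i2 i3)"
  define V where "V = (\<lambda>(l, g) b j2 j3. \<Sum>y\<in>?W. w y * e y g * cliff y b l * cliff y j2 j3)"
  have "(\<Sum>y\<in>?W. \<Sum>x\<in>?W. (w x * w y * kmat c 0 0 0 x y)
        * (\<Sum>l\<in>?w. cliff x a l * cliff y b l) * cliff x i2 i3 * cliff y j2 j3)
      = (\<Sum>h\<in>?w \<times> ?G. U h a i2 i3 * V h b j2 j3)" for a b i2 i3 j2 j3
  proof -
    have "(\<Sum>y\<in>?W. \<Sum>x\<in>?W. (w x * w y * kmat c 0 0 0 x y)
        * (\<Sum>l\<in>?w. cliff x a l * cliff y b l) * cliff x i2 i3 * cliff y j2 j3)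
      = (\<Sum>y\<in>?W. \<Sum>x\<in>?W. \<Sum>l\<in>?w. \<Sum>g\<in>?G. (w x * kmat c 0 0 0 x g * cliff x a l * cliff x i2 i3)
          * (w y * e y g * cliff y b l * cliff y j2 j3))"
      by (intro sum.cong refl) (simp add: e sum_distrib_left sum_distrib_right mult_ac, rule sum.swap)
    also have "\<dots> = (\<Sum>l\<in>?w. \<Sum>g\<in>?G. \<Sum>y\<in>?W. \<Sum>x\<in>?W. (w x * kmat c 0 0 0 x g * cliff x a l * cliff x i2 i3)
          * (w y * e y g * cliff y b l * cliff y j2 j3))"
      by (simp only: sum.swap[of _ ?w ?W] sum.swap[of _ ?G ?W])
    also have "\<dots> = (\<Sum>l\<in>?w. \<Sum>g\<in>?G. U (l, g) a i2 i3 * V (l, g) b j2 j3)"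
      by (simp add: U_def V_def sum_product) (intro sum.cong refl sum.swap)
    finally show ?thesis by (simp add: sum.cartesian_product)
  qed
  with that show thesis by blast
qed

section \<open>Decomposition of the threefold identity\<close>

definition decomp :: "('p \<Rightarrow> 'a::comm_ring_1) set \<Rightarrow> 'p set \<Rightarrow> ('p \<Rightarrow> 'a) \<Rightarrow> nat \<Rightarrow> bool" where
  "decomp T D f R \<longleftrightarrow> (\<exists>L. length L \<le> R \<and> set L \<subseteq> T \<and> (\<forall>p\<in>D. f p = (\<Sum>t\<leftarrow>L. t p)))"

lemma decomp_mono: "decomp T D f R \<Longrightarrow> R \<le> R' \<Longrightarrow> decomp T D f R'"
  by (meson le_trans decomp_def)

lemma decomp_cong: "decomp T D f R \<Longrightarrow> (\<And>p. p \<in> D \<Longrightarrow> g p = f p) \<Longrightarrow> decomp T D g R"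
  by (auto simp: decomp_def)

lemma decomp_single: "t \<in> T \<Longrightarrow> decomp T D t 1"
  unfolding decomp_def by (intro exI[of _ "[t]"]) simp

lemma decomp_sum:
  assumes "finite X" "\<And>x. x \<in> X \<Longrightarrow> decomp T D (f x) r"
  shows "decomp T D (\<lambda>p. \<Sum>x\<in>X. f x p) (card X * r)"
  using assms
proof (induction X rule: finite_induct)
  case empty
  then show ?case by (auto simp: decomp_def)
next
  case (insert x X)
  then obtain L L' where "length L \<le> card X * r" "set L \<subseteq> T" "\<forall>p\<in>D. (\<Sum>x\<in>X. f x p) = (\<Sum>t\<leftarrow>L. t p)"
    "length L' \<le> r" "set L' \<subseteq> T" "\<forall>p\<in>D. f x p = (\<Sum>t\<leftarrow>L'. t p)"
    unfolding decomp_def by (metis insertI1 insertI2)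
  with insert.hyps show ?case
    unfolding decomp_def by (intro exI[of _ "L' @ L"]) auto
qed

text \<open>The flags \<open>a\<close> and \<open>b\<close> tell whether the first and the third factor are transposed.\<close>

definition cut_products :: "('i \<times> 'i \<times> 'i \<times> 'i \<times> 'i \<times> 'i \<Rightarrow> 'a::comm_ring_1) set" where
  "cut_products = {\<lambda>(i1, i2, i3, j1, j2, j3). u (if a then j1 else i1) i2 (if b then j3 else i3)
                * v (if a then i1 else j1) j2 (if b then i3 else j3) | a b u v. True}"

definition word_sextuples :: "nat \<Rightarrow> (bool list \<times> bool list \<times> bool list \<times> bool list \<times> bool list \<times> bool list) set" where
  "word_sextuples s = words s \<times> words s \<times> words s \<times> words s \<times> words s \<times> words s"

lemma cut_productsI:
  "t = (\<lambda>(i1, i2, i3, j1, j2, j3). u (if a then j1 else i1) i2 (if b then j3 else i3)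
                * v (if a then i1 else j1) j2 (if b then i3 else j3)) \<Longrightarrow> t \<in> cut_products"
  unfolding cut_products_def by blast

lemma detshift_zero: "detshift (\<lambda>_ _ _. 0) = (\<lambda>_ _ _. 0)"
  by (simp add: detshift_def fun_eq_iff)

lemma CHAR_2_field: "CHAR('a::field) \<noteq> 2 \<Longrightarrow> (2::'a) \<noteq> 0"
proof
  assume "CHAR('a) \<noteq> 2" "(2::'a) = 0"
  then have "of_nat 2 = (0::'a)" by simp
  then have "CHAR('a) dvd 2" by (simp only: of_nat_eq_0_iff_char_dvd)
  then have "CHAR('a) \<le> 2" by (rule dvd_imp_le) simp
  moreover have "CHAR('a) \<noteq> 1" by simp
  moreover have "CHAR('a) \<noteq> 0" using \<open>CHAR('a) dvd 2\<close> by (intro notI) simp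
  ultimately show False using \<open>CHAR('a) \<noteq> 2\<close> by simp
qed

lemma decomp_family:
  assumes "finite J" "\<And>h. h \<in> J \<Longrightarrow> t h \<in> T" "\<And>p. p \<in> D \<Longrightarrow> f p = (\<Sum>h\<in>J. t h p)"
  shows "decomp T D f (card J)"
proof -
  have "decomp T D (\<lambda>p. \<Sum>h\<in>J. t h p) (card J * 1)"
    using assms by (intro decomp_sum decomp_single)
  then show ?thesis using assms(3) by (auto intro: decomp_cong)
qed

text \<open>The alternatives are the cuts with nothing, the first factor or the third factor
  transposed. The factor \<open>2 ^ s\<close> of the completeness relation is divided out, so 2 must
  be invertible.\<close>

lemma cliff_tensor_decomp:
  fixes c :: "nat \<Rightarrow> nat \<Rightarrow> nat \<Rightarrow> 'a::field"
  assumes two: "(2::'a) \<noteq> 0" and c: "even_kernel c"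
    and detshift: "(detshift ^^ k) c = (\<lambda>_ _ _. 0) \<or> (detshift ^^ k) (flip_sign c) = (\<lambda>_ _ _. 0)
      \<or> (detshift ^^ k) (flip_sign (swap_letters c)) = (\<lambda>_ _ _. 0)"
  shows "decomp cut_products (word_sextuples s) (\<lambda>(i1, i2, i3, j1, j2, j3). cliff_tensor s c i1 i2 i3 j1 j2 j3)
    (2 ^ s * card (few_matched k (2 * s)))"
proof -
  let ?J = "words s \<times> few_matched k (2*s)"
  have card: "card ?J = 2 ^ s * card (few_matched k (2 * s))" and fin: "finite ?J"
    by (simp_all add: card_words)
  have div: "x = (1 / 2 ^ s) * y" if "2 ^ s * x = y" for x y :: 'a
    using that two by (auto simp: field_simps)
  from detshift consider "(detshift ^^ k) c = (\<lambda>_ _ _. 0)" | "(detshift ^^ k) (flip_sign c) = (\<lambda>_ _ _. 0)"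
    | "(detshift ^^ k) (flip_sign (swap_letters c)) = (\<lambda>_ _ _. 0)" by blast
  then show ?thesis
  proof cases
    case 1
    obtain U V where UV: "\<And>a b i2 i3 j2 j3. (\<Sum>y\<in>words (2*s). \<Sum>x\<in>words (2*s). (1 * 1 * kmat c 0 0 0 x y)
        * (\<Sum>l\<in>words s. cliff x a l * cliff y b l) * cliff x i2 i3 * cliff y j2 j3)
      = (\<Sum>h\<in>?J. U h a i2 i3 * V h b j2 j3)"
      by (rule kmat_factor[OF 1, where s = s and w = "\<lambda>_. 1"]) blast
    show ?thesis
      unfolding card[symmetric]
    proof (rule decomp_family[OF fin, of "\<lambda>h (i1, i2, i3, j1, j2, j3). (1 / 2 ^ s * U h i1 i2 i3) * V h j1 j2 j3"], goal_cases)
      case (1 h)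
      show ?case by (rule cut_productsI[of _ "\<lambda>x y z. 1 / 2 ^ s * U h x y z" False False "V h"]) auto
    next
      case (2 p)
      then obtain i1 i2 i3 j1 j2 j3 where p: "p = (i1, i2, i3, j1, j2, j3)"
        and w: "i1 \<in> words s" "i2 \<in> words s" "i3 \<in> words s" "j1 \<in> words s" "j2 \<in> words s" "j3 \<in> words s"
        by (auto simp: word_sextuples_def)
      have "cliff_tensor s c i1 i2 i3 j1 j2 j3 = 1 / 2 ^ s * (\<Sum>h\<in>?J. U h i1 i2 i3 * V h j1 j2 j3)"
        using cliff_tensor_cut0[OF c] w UV[unfolded mult_1] by (intro div) simp
      then show ?case
        by (simp only: p prod.case sum_distrib_left mult.assoc)
    qed
  next
    case 2
    obtain U V where UV: "\<And>a b i2 i3 j2 j3. (\<Sum>y\<in>words (2*s). \<Sum>x\<in>words (2*s). (msign x * msign y * kmat (flip_sign c) 0 0 0 x y)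
        * (\<Sum>l\<in>words s. cliff x a l * cliff y b l) * cliff x i2 i3 * cliff y j2 j3)
      = (\<Sum>h\<in>?J. U h a i2 i3 * V h b j2 j3)"
      by (rule kmat_factor[OF 2, where s = s and w = msign]) blast
    show ?thesis
      unfolding card[symmetric]
    proof (rule decomp_family[OF fin, of "\<lambda>h (i1, i2, i3, j1, j2, j3). (1 / 2 ^ s * U h j1 i2 i3) * V h i1 j2 j3"], goal_cases)
      case (1 h)
      show ?case by (rule cut_productsI[of _ "\<lambda>x y z. 1 / 2 ^ s * U h x y z" True False "V h"]) auto
    next
      case (2 p)
      then obtain i1 i2 i3 j1 j2 j3 where p: "p = (i1, i2, i3, j1, j2, j3)"
        and w: "i1 \<in> words s" "i2 \<in> words s" "i3 \<in> words s" "j1 \<in> words s" "j2 \<in> words s" "j3 \<in> words s"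
        by (auto simp: word_sextuples_def)
      have "cliff_tensor s c i1 i2 i3 j1 j2 j3 = 1 / 2 ^ s * (\<Sum>h\<in>?J. U h j1 i2 i3 * V h i1 j2 j3)"
        using cliff_tensor_cut1[OF c] w UV by (intro div) simp
      then show ?case
        by (simp only: p prod.case sum_distrib_left mult.assoc)
    qed
  next
    case 3
    have c': "even_kernel (swap_letters c)"
      using c by (auto simp: even_kernel_def swap_letters_def)
    obtain U V where UV: "\<And>a b i2 i3 j2 j3. (\<Sum>y\<in>words (2*s). \<Sum>x\<in>words (2*s). (msign x * msign y * kmat (flip_sign (swap_letters c)) 0 0 0 x y)
        * (\<Sum>l\<in>words s. cliff x a l * cliff y b l) * cliff x i2 i3 * cliff y j2 j3)
      = (\<Sum>h\<in>?J. U h a i2 i3 * V h b j2 j3)"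
      by (rule kmat_factor[OF 3, where s = s and w = msign]) blast
    show ?thesis
      unfolding card[symmetric]
    proof (rule decomp_family[OF fin, of "\<lambda>h (i1, i2, i3, j1, j2, j3). (1 / 2 ^ s * U h j3 i2 i1) * V h i3 j2 j1"], goal_cases)
      case (1 h)
      show ?case by (rule cut_productsI[of _ "\<lambda>x y z. 1 / 2 ^ s * U h z y x" False True "\<lambda>x y z. V h z y x"]) auto
    next
      case (2 p)
      then obtain i1 i2 i3 j1 j2 j3 where p: "p = (i1, i2, i3, j1, j2, j3)"
        and w: "i1 \<in> words s" "i2 \<in> words s" "i3 \<in> words s" "j1 \<in> words s" "j2 \<in> words s" "j3 \<in> words s"
        by (auto simp: word_sextuples_def)
      have "cliff_tensor s c i1 i2 i3 j1 j2 j3 = cliff_tensor s (swap_letters c) i3 i2 i1 j3 j2 j1"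
        using w by (intro cliff_tensor_reverse[OF c])
      also have "\<dots> = 1 / 2 ^ s * (\<Sum>h\<in>?J. U h j3 i2 i1 * V h i3 j2 j1)"
        using cliff_tensor_cut1[OF c'] w UV by (intro div) simp
      finally show ?case
        by (simp only: p prod.case sum_distrib_left mult.assoc)
    qed
  qed
qed

section \<open>Expansion in the three determinant forms\<close>

definition sh0 :: "(nat \<Rightarrow> nat \<Rightarrow> nat \<Rightarrow> 'a::zero) \<Rightarrow> nat \<Rightarrow> nat \<Rightarrow> nat \<Rightarrow> 'a" where
  "sh0 g i j k = (case i of 0 \<Rightarrow> 0 | Suc i' \<Rightarrow> g i' j k)"

definition sh1 :: "(nat \<Rightarrow> nat \<Rightarrow> nat \<Rightarrow> 'a::zero) \<Rightarrow> nat \<Rightarrow> nat \<Rightarrow> nat \<Rightarrow> 'a" where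
  "sh1 g i j k = (case j of 0 \<Rightarrow> 0 | Suc j' \<Rightarrow> g i j' k)"

definition sh2 :: "(nat \<Rightarrow> nat \<Rightarrow> nat \<Rightarrow> 'a::zero) \<Rightarrow> nat \<Rightarrow> nat \<Rightarrow> nat \<Rightarrow> 'a" where
  "sh2 g i j k = (case k of 0 \<Rightarrow> 0 | Suc k' \<Rightarrow> g i j k')"

definition half :: "'a::field" where
  "half = inverse 2"

lemma half_double: "(2::'a::field) \<noteq> 0 \<Longrightarrow> half + half = (1::'a)"
  by (simp add: half_def flip: mult_2)

text \<open>\<open>coef p q r i j k\<close> is the coefficient of \<open>y\<^sub>0\<^sup>i y\<^sub>1\<^sup>j y\<^sub>2\<^sup>k\<close> in
\<open>((y\<^sub>1 + y\<^sub>2)/2)\<^sup>p ((y\<^sub>1 - y\<^sub>0)/2)\<^sup>q ((y\<^sub>2 - y\<^sub>0)/2)\<^sup>r\<close>.\<close>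

fun coef :: "nat \<Rightarrow> nat \<Rightarrow> nat \<Rightarrow> nat \<Rightarrow> nat \<Rightarrow> nat \<Rightarrow> 'a::field" where
  "coef 0 0 0 = (\<lambda>i j k. of_bool (i = 0 \<and> j = 0 \<and> k = 0))"
| "coef 0 0 (Suc r) = (\<lambda>i j k. half * (sh2 (coef 0 0 r) i j k - sh0 (coef 0 0 r) i j k))"
| "coef 0 (Suc q) r = (\<lambda>i j k. half * (sh1 (coef 0 q r) i j k - sh0 (coef 0 q r) i j k))"
| "coef (Suc p) q r = (\<lambda>i j k. half * (sh1 (coef p q r) i j k + sh2 (coef p q r) i j k))"

text \<open>\<open>coef\<close> peels off \<open>p\<close>, then \<open>q\<close>, then
  \<open>r\<close>. Since \<open>sh0\<close>, \<open>sh1\<close>, \<open>sh2\<close> are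
  multiplications by the three variables and commute, any factor may be peeled first.\<close>

lemma coef_q: "coef p (Suc q) r = (\<lambda>i j k. half * (sh1 (coef p q r) i j k - sh0 (coef p q r) i j k))"
proof (induction p)
  case (Suc p)
  show ?case
    unfolding coef.simps Suc.IH by (auto simp: sh0_def sh1_def sh2_def fun_eq_iff algebra_simps split: nat.split)
qed simp

lemma coef_r0: "coef 0 q (Suc r) = (\<lambda>i j k. half * (sh2 (coef 0 q r) i j k - sh0 (coef 0 q r) i j k))"
proof (induction q)
  case (Suc q)
  show ?case
    unfolding coef.simps Suc.IH by (auto simp: sh0_def sh1_def sh2_def fun_eq_iff algebra_simps split: nat.split)
qed simp

lemma coef_r: "coef p q (Suc r) = (\<lambda>i j k. half * (sh2 (coef p q r) i j k - sh0 (coef p q r) i j k))"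
proof (induction p)
  case (Suc p)
  show ?case
    unfolding coef.simps Suc.IH by (auto simp: sh0_def sh1_def sh2_def fun_eq_iff algebra_simps split: nat.split)
qed (rule coef_r0)

text \<open>The linear forms behind \<open>coef\<close> are the solution of
  \<open>a - b - c = y\<^sub>0\<close>, \<open>a + b - c = y\<^sub>1\<close>,
  \<open>a - b + c = y\<^sub>2\<close>.\<close>

lemma coef_rel:
  assumes "(2::'a::field) \<noteq> 0"
  shows "coef (Suc p) q r i j k - coef p (Suc q) r i j k - coef p q (Suc r) i j k = (sh0 (coef p q r) i j k :: 'a)"
    and "coef (Suc p) q r i j k + coef p (Suc q) r i j k - coef p q (Suc r) i j k = (sh1 (coef p q r) i j k :: 'a)"
    and "coef (Suc p) q r i j k - coef p (Suc q) r i j k + coef p q (Suc r) i j k = (sh2 (coef p q r) i j k :: 'a)"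
proof -
  have "half * x + half * x = x" for x :: 'a
    using half_double[OF assms] by (simp flip: distrib_right)
  then show "coef (Suc p) q r i j k - coef p (Suc q) r i j k - coef p q (Suc r) i j k = (sh0 (coef p q r) i j k :: 'a)"
    and "coef (Suc p) q r i j k + coef p (Suc q) r i j k - coef p q (Suc r) i j k = (sh1 (coef p q r) i j k :: 'a)"
    and "coef (Suc p) q r i j k - coef p (Suc q) r i j k + coef p q (Suc r) i j k = (sh2 (coef p q r) i j k :: 'a)"
    by (simp_all add: coef_q coef_r algebra_simps)
qed

definition simplex :: "nat \<Rightarrow> (nat \<times> nat \<times> nat) set" where
  "simplex D = {(i, j, k). i + j + k = D}"

lemma simplex_subset: "simplex D \<subseteq> (\<lambda>(i, j). (i, j, D - i - j)) ` ({..D} \<times> {..D})"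
  by (auto simp: simplex_def image_iff)

lemma finite_simplex [simp]: "finite (simplex D)"
  by (rule finite_subset[OF simplex_subset]) simp

lemma card_simplex: "card (simplex D) \<le> (D + 1) ^ 2"
proof -
  have "card (simplex D) \<le> card ({..D} \<times> {..D})"
    by (rule surj_card_le[OF _ simplex_subset]) simp
  then show ?thesis by (simp add: power2_eq_square)
qed

lemma sum_simplex_shift:
  fixes g :: "nat \<Rightarrow> nat \<Rightarrow> nat \<Rightarrow> 'a::comm_monoid_add"
  shows "(\<Sum>(i, j, k)\<in>simplex (Suc D). sh0 g i j k) = (\<Sum>(i, j, k)\<in>simplex D. g i j k)" (is ?A)
    and "(\<Sum>(i, j, k)\<in>simplex (Suc D). sh1 g i j k) = (\<Sum>(i, j, k)\<in>simplex D. g i j k)" (is ?B)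
    and "(\<Sum>(i, j, k)\<in>simplex (Suc D). sh2 g i j k) = (\<Sum>(i, j, k)\<in>simplex D. g i j k)" (is ?C)
proof -
  have "(\<Sum>(i, j, k)\<in>simplex (Suc D). sh0 g i j k) = (\<Sum>(i, j, k)\<in>simplex (Suc D) \<inter> {(i, j, k). i \<noteq> 0}. sh0 g i j k)"
    by (rule sum.mono_neutral_right) (auto simp: sh0_def split: nat.splits)
  also have "\<dots> = (\<Sum>(i, j, k)\<in>simplex D. g i j k)"
    by (rule sum.reindex_bij_witness[where i = "\<lambda>(i, j, k). (Suc i, j, k)" and j = "\<lambda>(i, j, k). (i - 1, j, k)"])
       (auto simp: simplex_def sh0_def split: nat.splits)
  finally show ?A .
  have "(\<Sum>(i, j, k)\<in>simplex (Suc D). sh1 g i j k) = (\<Sum>(i, j, k)\<in>simplex (Suc D) \<inter> {(i, j, k). j \<noteq> 0}. sh1 g i j k)"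
    by (rule sum.mono_neutral_right) (auto simp: sh1_def split: nat.splits)
  also have "\<dots> = (\<Sum>(i, j, k)\<in>simplex D. g i j k)"
    by (rule sum.reindex_bij_witness[where i = "\<lambda>(i, j, k). (i, Suc j, k)" and j = "\<lambda>(i, j, k). (i, j - 1, k)"])
       (auto simp: simplex_def sh1_def split: nat.splits)
  finally show ?B .
  have "(\<Sum>(i, j, k)\<in>simplex (Suc D). sh2 g i j k) = (\<Sum>(i, j, k)\<in>simplex (Suc D) \<inter> {(i, j, k). k \<noteq> 0}. sh2 g i j k)"
    by (rule sum.mono_neutral_right) (auto simp: sh2_def split: nat.splits)
  also have "\<dots> = (\<Sum>(i, j, k)\<in>simplex D. g i j k)"
    by (rule sum.reindex_bij_witness[where i = "\<lambda>(i, j, k). (i, j, Suc k)" and j = "\<lambda>(i, j, k). (i, j, k - 1)"])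
       (auto simp: simplex_def sh2_def split: nat.splits)
  finally show ?C .
qed

text \<open>Setting all three variables to 1 turns the first form into 1 and the other two into
  0.\<close>

lemma sum_coef:
  assumes two: "(2::'a::field) \<noteq> 0"
  shows "(\<Sum>(i, j, k)\<in>simplex (p + q + r). coef p q r i j k) = (of_bool (q = 0 \<and> r = 0) :: 'a)"
proof -
  note shift = sum_simplex_shift[unfolded case_prod_unfold]
  show ?thesis
    unfolding case_prod_unfold
  proof (induction p q r rule: coef.induct)
    case 1
    have "simplex 0 = {(0, 0, 0)}" by (auto simp: simplex_def)
    then show ?case by simp
  next
    case (4 p q r)
    then show ?case
      using half_double[OF two] by (simp add: sum.distrib shift flip: sum_distrib_left) (simp add: mult.commute[of half] flip: distrib_left mult_2_right)
  qed (simp_all add: sum_subtractf shift flip: sum_distrib_left)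
qed

text \<open>Only words in which every letter occurs evenly often are used, so that the quadratic form
\<open>x\<^sub>1\<^sup>2 - x\<^sub>X\<^sup>2 - x\<^sub>Z\<^sup>2\<close> (the determinant) acts as a linear form on the halved exponents.\<close>

definition coef_kernel :: "nat \<Rightarrow> nat \<Rightarrow> nat \<Rightarrow> nat \<Rightarrow> nat \<Rightarrow> nat \<Rightarrow> 'a::field" where
  "coef_kernel i j k p q r = of_bool (even p \<and> even q \<and> even r) * coef (p div 2) (q div 2) (r div 2) i j k"

lemma even_coef_kernel: "even_kernel (coef_kernel i j k)"
  by (auto simp: even_kernel_def coef_kernel_def)

text \<open>By \<open>coef_rel\<close>, \<open>detshift\<close> multiplies by
  \<open>y\<^sub>0\<close>, \<open>y\<^sub>1\<close> or \<open>y\<^sub>2\<close> according to the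
  cut, so the exponent \<open>i\<close>, \<open>j\<close> or \<open>k\<close> drops by one and the
  kernel dies after exponent 0.\<close>

lemma detshift_coef_kernel:
  assumes two: "(2::'a::field) \<noteq> 0"
  shows "detshift (coef_kernel i j k) = (case i of 0 \<Rightarrow> \<lambda>_ _ _. 0 | Suc i' \<Rightarrow> (coef_kernel i' j k :: nat \<Rightarrow> nat \<Rightarrow> nat \<Rightarrow> 'a))"
    and "detshift (flip_sign (coef_kernel i j k)) = (case j of 0 \<Rightarrow> \<lambda>_ _ _. 0 | Suc j' \<Rightarrow> flip_sign (coef_kernel i j' k :: nat \<Rightarrow> nat \<Rightarrow> nat \<Rightarrow> 'a))"
    and "detshift (flip_sign (swap_letters (coef_kernel i j k))) = (case k of 0 \<Rightarrow> \<lambda>_ _ _. 0 | Suc k' \<Rightarrow> flip_sign (swap_letters (coef_kernel i j k' :: nat \<Rightarrow> nat \<Rightarrow> nat \<Rightarrow> 'a)))"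
proof -
  note rel = coef_rel[OF two, of "p div 2" "q div 2" "r div 2" i j k for p q r]
  have d: "(n + 2) div 2 = Suc (n div 2)" "even (n + 2) = even n" for n :: nat by simp_all
  have "detshift (coef_kernel i j k) p q r = of_bool (even p \<and> even q \<and> even r) * (sh0 (coef (p div 2) (q div 2) (r div 2)) i j k :: 'a)"
    for p q r
    unfolding detshift_def coef_kernel_def d by (cases "even p \<and> even q \<and> even r") (auto simp del: coef.simps simp flip: rel)
  then show "detshift (coef_kernel i j k) = (case i of 0 \<Rightarrow> \<lambda>_ _ _. 0 | Suc i' \<Rightarrow> (coef_kernel i' j k :: nat \<Rightarrow> nat \<Rightarrow> nat \<Rightarrow> 'a))"
    by (auto simp: fun_eq_iff sh0_def coef_kernel_def split: nat.splits)
  have "detshift (flip_sign (coef_kernel i j k)) p q r = bsign (odd (q div 2)) * (of_bool (even p \<and> even q \<and> even r)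
      * (sh1 (coef (p div 2) (q div 2) (r div 2)) i j k :: 'a))"
    for p q r
    unfolding detshift_def coef_kernel_def d flip_sign_def
    by (cases "odd (q div 2)"; cases "even p \<and> even q \<and> even r") (auto simp del: coef.simps simp flip: rel)
  then show "detshift (flip_sign (coef_kernel i j k)) = (case j of 0 \<Rightarrow> \<lambda>_ _ _. 0 | Suc j' \<Rightarrow> flip_sign (coef_kernel i j' k :: nat \<Rightarrow> nat \<Rightarrow> nat \<Rightarrow> 'a))"
    by (auto simp: fun_eq_iff sh1_def coef_kernel_def flip_sign_def split: nat.splits)
  \<comment> \<open>Evaluated at \<open>p r q\<close> because \<open>swap_letters\<close> exchanges
    the last two counts.\<close>
  have "detshift (flip_sign (swap_letters (coef_kernel i j k))) p r q = bsign (odd (r div 2)) * (of_bool (even p \<and> even q \<and> even r)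
      * (sh2 (coef (p div 2) (q div 2) (r div 2)) i j k :: 'a))"
    for p q r
    unfolding detshift_def coef_kernel_def d flip_sign_def swap_letters_def
    by (cases "odd (r div 2)"; cases "even p \<and> even q \<and> even r") (auto simp del: coef.simps simp flip: rel)
  then show "detshift (flip_sign (swap_letters (coef_kernel i j k))) = (case k of 0 \<Rightarrow> \<lambda>_ _ _. 0 | Suc k' \<Rightarrow> flip_sign (swap_letters (coef_kernel i j k' :: nat \<Rightarrow> nat \<Rightarrow> nat \<Rightarrow> 'a)))"
    by (auto simp: fun_eq_iff sh2_def coef_kernel_def flip_sign_def swap_letters_def split: nat.splits)
qed

lemma detshift_chain:
  assumes "\<And>i. detshift (F i) = (case i of 0 \<Rightarrow> \<lambda>_ _ _. 0 | Suc i' \<Rightarrow> F i')"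
  shows "i < k \<Longrightarrow> (detshift ^^ k) (F i) = (\<lambda>_ _ _. 0)"
proof (induction k arbitrary: i)
  case (Suc k)
  have z: "(detshift ^^ k) (\<lambda>_ _ _. 0) = (\<lambda>_ _ _. 0 :: 'a)"
    by (induction k) (simp_all add: detshift_zero)
  show ?case
  proof (cases i)
    case 0
    then show ?thesis using assms[of 0] z by (simp add: funpow_swap1)
  next
    case (Suc i')
    then show ?thesis using assms[of i] Suc.IH[of i'] Suc.prems by (simp add: funpow_swap1)
  qed
qed simp

text \<open>By \<open>sum_coef\<close> the kernels with \<open>i + j + k = s\<close> add up, on
  words of length \<open>2 * s\<close>, to the kernel of the identity, and each is killed by
  \<open>s div 3 + 1\<close> singlets in some cut.\<close>

lemma threefold_identity_decomp:
  assumes two: "(2::'a::field) \<noteq> 0"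
  shows "decomp cut_products (word_sextuples s)
    (\<lambda>(i1, i2, i3, j1, j2, j3). of_bool (i1 = j1 \<and> i2 = j2 \<and> i3 = j3) :: 'a)
    ((s + 1) ^ 2 * (2 ^ s * card (few_matched (Suc (s div 3)) (2 * s))))"
proof -
  let ?R = "2 ^ s * card (few_matched (Suc (s div 3)) (2 * s))"
  define f :: "nat \<times> nat \<times> nat \<Rightarrow> _ \<Rightarrow> 'a" where
    "f = (\<lambda>(i, j, k) (i1, i2, i3, j1, j2, j3). cliff_tensor s (coef_kernel i j k) i1 i2 i3 j1 j2 j3)"
  have "decomp cut_products (word_sextuples s) (\<lambda>p. \<Sum>\<alpha>\<in>simplex s. f \<alpha> p) (card (simplex s) * ?R)"
  proof (rule decomp_sum)
    fix \<alpha> assume "\<alpha> \<in> simplex s"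
    then obtain i j k where \<alpha>: "\<alpha> = (i, j, k)" "i + j + k = s"
      by (auto simp: simplex_def)
    then consider "i < Suc (s div 3)" | "j < Suc (s div 3)" | "k < Suc (s div 3)"
      by linarith
    then have "(detshift ^^ Suc (s div 3)) (coef_kernel i j k) = (\<lambda>_ _ _. 0::'a) \<or>
      (detshift ^^ Suc (s div 3)) (flip_sign (coef_kernel i j k)) = (\<lambda>_ _ _. 0::'a) \<or>
      (detshift ^^ Suc (s div 3)) (flip_sign (swap_letters (coef_kernel i j k))) = (\<lambda>_ _ _. 0::'a)"
      using detshift_chain[of "\<lambda>i. coef_kernel i j k :: nat \<Rightarrow> nat \<Rightarrow> nat \<Rightarrow> 'a", OF detshift_coef_kernel(1)[OF two]]
        detshift_chain[of "\<lambda>j. flip_sign (coef_kernel i j k :: nat \<Rightarrow> nat \<Rightarrow> nat \<Rightarrow> 'a)", OF detshift_coef_kernel(2)[OF two]]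
        detshift_chain[of "\<lambda>k. flip_sign (swap_letters (coef_kernel i j k :: nat \<Rightarrow> nat \<Rightarrow> nat \<Rightarrow> 'a))", OF detshift_coef_kernel(3)[OF two]]
      by metis
    from cliff_tensor_decomp[OF two even_coef_kernel this]
    show "decomp cut_products (word_sextuples s) (f \<alpha>) ?R"
      by (simp add: f_def \<alpha>(1))
  qed simp
  then have "decomp cut_products (word_sextuples s) (\<lambda>p. \<Sum>\<alpha>\<in>simplex s. f \<alpha> p) ((s + 1) ^ 2 * ?R)"
    by (rule decomp_mono) (intro mult_right_mono card_simplex, simp)
  then show ?thesis
  proof (rule decomp_cong)
    fix p assume "p \<in> word_sextuples s"
    then obtain i1 i2 i3 j1 j2 j3 where p: "p = (i1, i2, i3, j1, j2, j3)"
      and w: "i1 \<in> words s" "i2 \<in> words s" "i3 \<in> words s" "j1 \<in> words s" "j2 \<in> words s" "j3 \<in> words s"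
      by (auto simp: word_sextuples_def)
    define c :: "nat \<Rightarrow> nat \<Rightarrow> nat \<Rightarrow> 'a" where
      "c = (\<lambda>p q r. \<Sum>\<alpha>\<in>simplex s. (\<lambda>(i, j, k). coef_kernel i j k) \<alpha> p q r)"
    have "c p q r = of_bool (q = 0 \<and> r = 0)" if "p + q + r = 2 * s" for p q r
    proof (cases "even p \<and> even q \<and> even r")
      case True
      then obtain p' q' r' where *: "p = 2 * p'" "q = 2 * q'" "r = 2 * r'"
        by (auto elim!: evenE)
      with that have "p' + q' + r' = s" by simp
      then show ?thesis
        using sum_coef[OF two, of p' q' r'] by (simp add: c_def coef_kernel_def * case_prod_unfold)
    next
      case False
      have "\<not> (q = 0 \<and> r = 0)"
      proof
        assume "q = 0 \<and> r = 0"
        with that have "p = 2 * s" by simp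
        with False \<open>q = 0 \<and> r = 0\<close> show False by simp
      qed
      with False show ?thesis by (auto simp: c_def coef_kernel_def case_prod_unfold)
    qed
    from cliff_tensor_unit[of s c, OF this w]
    have "cliff_tensor s c i1 i2 i3 j1 j2 j3 = of_bool (i1 = j1 \<and> i2 = j2 \<and> i3 = j3)" .
    also have "cliff_tensor s c i1 i2 i3 j1 j2 j3 = (\<Sum>\<alpha>\<in>simplex s. f \<alpha> p)"
      unfolding c_def cliff_tensor_sum by (simp add: f_def p case_prod_unfold)
    finally show "(case p of (i1, i2, i3, j1, j2, j3) \<Rightarrow> of_bool (i1 = j1 \<and> i2 = j2 \<and> i3 = j3)) = (\<Sum>\<alpha>\<in>simplex s. f \<alpha> p)"
      by (simp add: p)
  qed
qed

section \<open>From words to partial transposes\<close>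

text \<open>A linear substitution acts term by term. Membership in \<open>T'\<close> is asked only
  up to equality on \<open>D'\<close>, since in \<open>block_decomp\<close> the terms take product
  form on valid indices.\<close>

lemma decomp_map_on:
  assumes "decomp T D f R"
    and f': "\<And>q. q \<in> D' \<Longrightarrow> f' q = (\<Sum>k\<in>Q. w q k * f (\<phi> q k))"
    and \<phi>: "\<And>q k. q \<in> D' \<Longrightarrow> k \<in> Q \<Longrightarrow> \<phi> q k \<in> D"
    and T': "\<And>t. t \<in> T \<Longrightarrow> \<exists>t'\<in>T'. \<forall>q\<in>D'. t' q = (\<Sum>k\<in>Q. w q k * t (\<phi> q k))"
  shows "decomp T' D' f' R"
proof -
  obtain L where L: "length L \<le> R" "set L \<subseteq> T" "\<forall>p\<in>D. f p = (\<Sum>t\<leftarrow>L. t p)"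
    using assms(1) by (auto simp: decomp_def)
  have "\<forall>t\<in>T. \<exists>t'. t' \<in> T' \<and> (\<forall>q\<in>D'. t' q = (\<Sum>k\<in>Q. w q k * t (\<phi> q k)))"
    using T' by blast
  then obtain \<tau> where \<tau>: "\<forall>t\<in>T. \<tau> t \<in> T' \<and> (\<forall>q\<in>D'. \<tau> t q = (\<Sum>k\<in>Q. w q k * t (\<phi> q k)))"
    by (elim bchoice[elim_format] exE)
  have "f' q = (\<Sum>t\<leftarrow>map \<tau> L. t q)" if q: "q \<in> D'" for q
  proof -
    have sw: "set M \<subseteq> T \<Longrightarrow> (\<Sum>k\<in>Q. w q k * (\<Sum>t\<leftarrow>M. t (\<phi> q k))) = (\<Sum>t\<leftarrow>M. \<tau> t q)" for M
      using \<tau> q by (induction M) (simp_all add: distrib_left sum.distrib)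
    have "f' q = (\<Sum>k\<in>Q. w q k * (\<Sum>t\<leftarrow>L. t (\<phi> q k)))"
      using L(3) \<phi>[OF q] unfolding f'[OF q] by (intro sum.cong) auto
    then show ?thesis by (simp add: sw[OF L(2)] comp_def)
  qed
  with L \<tau> show ?thesis
    unfolding decomp_def by (intro exI[of _ "map \<tau> L"]) auto
qed

lemma decomp_map:
  assumes "decomp T D f R"
    and "\<And>q. q \<in> D' \<Longrightarrow> f' q = (\<Sum>k\<in>Q. w q k * f (\<phi> q k))"
    and "\<And>q k. q \<in> D' \<Longrightarrow> k \<in> Q \<Longrightarrow> \<phi> q k \<in> D"
    and "\<And>t. t \<in> T \<Longrightarrow> (\<lambda>q. \<Sum>k\<in>Q. w q k * t (\<phi> q k)) \<in> T'"
  shows "decomp T' D' f' R"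
  using assms by (intro decomp_map_on[OF assms(1-3)]) auto

lemma sum_of_bool:
  assumes "finite A" "a \<in> A"
  shows "(\<Sum>k\<in>A. of_bool (a = k) * f k) = (f a :: 'a::comm_ring_1)"
    and "(\<Sum>k\<in>A. f k * of_bool (a = k)) = (f a :: 'a::comm_ring_1)"
  using assms by (simp_all add: sum.remove[of A a])

text \<open>Contracting one column index affects only \<open>u\<close> or only \<open>v\<close>,
  depending on the transposition flag of its factor, so the cut and the product form survive. The
  three factors are contracted in turn.\<close>

lemma product_decomp:
  fixes F1 F2 F3 :: "bool list \<Rightarrow> bool list \<Rightarrow> 'a::comm_ring_1"
  assumes "decomp cut_products (word_sextuples s)
    (\<lambda>(i1, i2, i3, j1, j2, j3). of_bool (i1 = j1 \<and> i2 = j2 \<and> i3 = j3) :: 'a) R"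
  shows "decomp cut_products (word_sextuples s) (\<lambda>(i1, i2, i3, j1, j2, j3). F1 i1 j1 * F2 i2 j2 * F3 i3 j3) R"
proof -
  let ?w = "words s"
  have 1: "decomp cut_products (word_sextuples s) (\<lambda>(i1, i2, i3, j1, j2, j3). F1 i1 j1 * of_bool (i2 = j2 \<and> i3 = j3)) R"
  proof (rule decomp_map[OF assms, where Q = ?w
      and \<phi> = "\<lambda>(i1, i2, i3, j1, j2, j3) k. (i1, i2, i3, k, j2, j3)" and w = "\<lambda>(i1, i2, i3, j1, j2, j3) k. F1 k j1"], goal_cases)
    case (1 q)
    then show ?case
      by (auto simp: word_sextuples_def of_bool_conj sum_of_bool simp flip: mult.assoc sum_distrib_right)
  next
    case (3 t)
    then obtain a b u v where t: "t = (\<lambda>(i1, i2, i3, j1, j2, j3). u (if a then j1 else i1) i2 (if b then j3 else i3)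
                * v (if a then i1 else j1) j2 (if b then i3 else j3))"
      unfolding cut_products_def by blast
    show ?case
      by (rule cut_productsI[of _ "\<lambda>x y z. if a then \<Sum>k\<in>?w. F1 k x * u k y z else u x y z" a b
           "\<lambda>x y z. if a then v x y z else \<Sum>k\<in>?w. F1 k x * v k y z"])
         (auto simp: t fun_eq_iff sum_distrib_left sum_distrib_right mult_ac)
  qed (auto simp: word_sextuples_def)
  have 2: "decomp cut_products (word_sextuples s) (\<lambda>(i1, i2, i3, j1, j2, j3). F1 i1 j1 * F2 i2 j2 * of_bool (i3 = j3)) R"
  proof (rule decomp_map[OF 1, where Q = ?w
      and \<phi> = "\<lambda>(i1, i2, i3, j1, j2, j3) k. (i1, i2, i3, j1, k, j3)" and w = "\<lambda>(i1, i2, i3, j1, j2, j3) k. F2 k j2"], goal_cases)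
    case (1 q)
    then obtain i1 i2 i3 j1 j2 j3 where q: "q = (i1, i2, i3, j1, j2, j3)" "i2 \<in> ?w"
      by (auto simp: word_sextuples_def)
    have "(\<Sum>k\<in>?w. F2 k j2 * (F1 i1 j1 * of_bool (i2 = k \<and> i3 = j3)))
      = (\<Sum>k\<in>?w. of_bool (i2 = k) * (F1 i1 j1 * F2 k j2 * of_bool (i3 = j3)))"
      by (simp add: of_bool_conj mult_ac)
    then show ?case using q by (simp add: sum_of_bool)
  next
    case (3 t)
    then obtain a b u v where t: "t = (\<lambda>(i1, i2, i3, j1, j2, j3). u (if a then j1 else i1) i2 (if b then j3 else i3)
                * v (if a then i1 else j1) j2 (if b then i3 else j3))"
      unfolding cut_products_def by blast
    show ?case
      by (rule cut_productsI[of _ u a b "\<lambda>x y z. \<Sum>k\<in>?w. F2 k y * v x k z"])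
         (auto simp: t fun_eq_iff sum_distrib_left sum_distrib_right mult_ac)
  qed (auto simp: word_sextuples_def)
  show ?thesis
  proof (rule decomp_map[OF 2, where Q = ?w
      and \<phi> = "\<lambda>(i1, i2, i3, j1, j2, j3) k. (i1, i2, i3, j1, j2, k)" and w = "\<lambda>(i1, i2, i3, j1, j2, j3) k. F3 k j3"], goal_cases)
    case (1 q)
    then obtain i1 i2 i3 j1 j2 j3 where q: "q = (i1, i2, i3, j1, j2, j3)" "i3 \<in> ?w"
      by (auto simp: word_sextuples_def)
    have "(\<Sum>k\<in>?w. F3 k j3 * (F1 i1 j1 * F2 i2 j2 * of_bool (i3 = k)))
      = (\<Sum>k\<in>?w. of_bool (i3 = k) * (F1 i1 j1 * F2 i2 j2 * F3 k j3))"
      by (simp add: mult_ac)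
    then show ?case using q by (simp add: sum_of_bool)
  next
    case (3 t)
    then obtain a b u v where t: "t = (\<lambda>(i1, i2, i3, j1, j2, j3). u (if a then j1 else i1) i2 (if b then j3 else i3)
                * v (if a then i1 else j1) j2 (if b then i3 else j3))"
      unfolding cut_products_def by blast
    show ?case
      by (rule cut_productsI[of _ "\<lambda>x y z. if b then \<Sum>k\<in>?w. F3 k z * u x y k else u x y z" a b
           "\<lambda>x y z. if b then v x y z else \<Sum>k\<in>?w. F3 k z * v x y k"])
         (auto simp: t fun_eq_iff sum_distrib_left sum_distrib_right mult_ac)
  qed (auto simp: word_sextuples_def)
qed

definition sel :: "nat set \<Rightarrow> nat list \<Rightarrow> nat list \<Rightarrow> nat list" where
  "sel \<kappa> i j = map (\<lambda>k. if k \<in> \<kappa> then j ! k else i ! k) [0..<length i]"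

lemma ptrans_sel: "ptrans \<kappa> M r c = M (sel \<kappa> r c) (sel \<kappa> c r)"
  by (simp add: ptrans_def sel_def)

lemma sel_sel: "length i = length j \<Longrightarrow> sel \<kappa> (sel \<kappa> i j) (sel \<kappa> j i) = i"
  by (auto simp: sel_def intro!: nth_equalityI)

lemma sel_idx: "i \<in> idx n d \<Longrightarrow> j \<in> idx n d \<Longrightarrow> sel \<kappa> i j \<in> idx n d"
  by (auto simp: idx_def sel_def)

text \<open>Unlike \<open>PT_basic\<close> this admits zero matrices, so terms can be formed freely;
  \<open>PT_rank_le\<close> discards those vanishing on the index range.\<close>

definition ptset :: "nat \<Rightarrow> (nat list \<times> nat list \<Rightarrow> 'a::comm_ring_1) set" where
  "ptset d = {\<lambda>(i, j). u (sel \<kappa> i j) * v (sel \<kappa> j i) | \<kappa> u v. \<kappa> \<subseteq> {..<d}}"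

lemma ptset_basic:
  assumes "t \<in> ptset d" "i \<in> idx n d" "j \<in> idx n d" "t (i, j) \<noteq> 0"
  shows "PT_basic n d (\<lambda>i j. t (i, j))"
proof -
  obtain \<kappa> u v where \<kappa>: "\<kappa> \<subseteq> {..<d}" and t: "t = (\<lambda>(i, j). u (sel \<kappa> i j) * v (sel \<kappa> j i))"
    using assms(1) by (auto simp: ptset_def)
  have pt: "ptrans \<kappa> (\<lambda>i j. t (i, j)) r c = u r * v c" if "r \<in> idx n d" "c \<in> idx n d" for r c
    using that sel_sel[of r c \<kappa>] sel_sel[of c r \<kappa>] by (simp add: ptrans_sel t idx_def)
  have "rank_one n d (ptrans \<kappa> (\<lambda>i j. t (i, j)))"
    unfolding rank_one_def
  proof (intro conjI bexI exI ballI)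
    show "ptrans \<kappa> (\<lambda>i j. t (i, j)) (sel \<kappa> i j) (sel \<kappa> j i) \<noteq> 0"
      using assms(4) sel_idx[OF assms(2,3)] sel_idx[OF assms(3,2)] by (subst pt) (auto simp: t)
  qed (use pt sel_idx assms in auto)
  with \<kappa> show ?thesis
    unfolding PT_basic_def by blast
qed

lemma PT_rank_le:
  assumes "decomp (ptset d) (idx n d \<times> idx n d) (\<lambda>(i, j). M i j) R"
  shows "PT_rank n d M \<le> R"
proof -
  obtain L where L: "length L \<le> R" "set L \<subseteq> ptset d"
    and sum: "\<And>i j. i \<in> idx n d \<Longrightarrow> j \<in> idx n d \<Longrightarrow> M i j = (\<Sum>t\<leftarrow>L. t (i, j))"
    using assms by (auto simp: decomp_def)
  define nz where "nz = (\<lambda>t :: nat list \<times> nat list \<Rightarrow> 'a. \<exists>i\<in>idx n d. \<exists>j\<in>idx n d. t (i, j) \<noteq> 0)"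
  define Ms where "Ms = map (\<lambda>t i j. t (i, j)) (filter nz L)"
  have "(\<Sum>t\<leftarrow>L. t (i, j)) = (\<Sum>t\<leftarrow>filter nz L. t (i, j))" if "i \<in> idx n d" "j \<in> idx n d" for i j
    using that by (induction L) (auto simp: nz_def)
  with sum have "M i j = (\<Sum>B\<leftarrow>Ms. B i j)" if "i \<in> idx n d" "j \<in> idx n d" for i j
    using that by (simp add: Ms_def comp_def)
  moreover have "PT_basic n d B" if "B \<in> set Ms" for B
    using that L(2) ptset_basic by (fastforce simp: Ms_def nz_def)
  ultimately have "PT_rank n d M \<le> length Ms"
    unfolding PT_rank_def by (intro Least_le) blast
  also have "\<dots> \<le> R"
    using order_trans[OF length_filter_le L(1)] by (simp add: Ms_def)
  finally show ?thesis .
qed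

lemma idx_lists: "idx n d = {xs. set xs \<subseteq> {..<n} \<and> length xs = d}"
  by (auto simp: idx_def)

lemma finite_idx [simp]: "finite (idx n d)"
  by (simp add: idx_lists finite_lists_length_eq)

lemma card_idx: "card (idx n d) = n ^ d"
  by (simp add: idx_lists card_lists_length_eq)

text \<open>One term per matrix entry; this settles \<open>n = 1\<close> and \<open>d < 6\<close> at
  the end.\<close>

lemma PT_rank_trivial: "PT_rank n d M \<le> n ^ (2 * d)"
proof -
  have "decomp (ptset d) (idx n d \<times> idx n d)
    (\<lambda>q. \<Sum>r\<in>idx n d. \<Sum>c\<in>idx n d. (\<lambda>(i, j). (of_bool (i = r) * M r c) * of_bool (j = c)) q)
    (card (idx n d) * (card (idx n d) * 1))"
  proof (intro decomp_sum decomp_single finite_idx)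
    fix r c
    have s: "sel {} i j = i" for i j
      by (auto simp: sel_def intro: nth_equalityI)
    show "(\<lambda>(i, j). (of_bool (i = r) * M r c) * of_bool (j = c)) \<in> ptset d"
      unfolding ptset_def
      by (rule CollectI, rule exI[of _ "{}"], rule exI[of _ "\<lambda>i. of_bool (i = r) * M r c"], rule exI[of _ "\<lambda>j. of_bool (j = c)"])
         (simp add: s)
  qed
  then have "decomp (ptset d) (idx n d \<times> idx n d) (\<lambda>(i, j). M i j) (card (idx n d) * (card (idx n d) * 1))"
  proof (rule decomp_cong)
    fix q assume "q \<in> idx n d \<times> idx n d"
    then obtain i j where q: "q = (i, j)" "i \<in> idx n d" "j \<in> idx n d" by auto
    show "(case q of (i, j) \<Rightarrow> M i j)
      = (\<Sum>r\<in>idx n d. \<Sum>c\<in>idx n d. (\<lambda>(i, j). (of_bool (i = r) * M r c) * of_bool (j = c)) q)"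
      unfolding q(1) prod.case using q(2,3) by (simp only: sum_of_bool finite_idx)
  qed
  from PT_rank_le[OF this] show ?thesis
    by (simp add: card_idx mult_2 power_add)
qed

section \<open>Segments between two cut coordinates\<close>

definition seg :: "nat \<Rightarrow> nat \<Rightarrow> 'b list \<Rightarrow> 'b list" where
  "seg a b x = map ((!) x) [a..<b]"

lemma seg_sel:
  assumes "b \<le> length i"
  shows "{a..<b} \<subseteq> \<kappa> \<Longrightarrow> seg a b (sel \<kappa> i j) = seg a b j"
    and "{a..<b} \<inter> \<kappa> = {} \<Longrightarrow> seg a b (sel \<kappa> i j) = seg a b i"
  using assms by (auto simp: seg_def sel_def)

lemma seg_idx: "x \<in> idx n d \<Longrightarrow> b \<le> d \<Longrightarrow> seg a b x \<in> idx n (b - a)"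
  by (auto simp: seg_def idx_def)

lemma encode_idx:
  assumes "1 \<le> n" "l \<le> m" "n ^ m \<le> 2 ^ s"
  obtains e where "inj_on e (idx n l)" "e ` idx n l \<subseteq> words s"
proof -
  have "n ^ l \<le> n ^ m"
    using assms by (intro power_increasing) auto
  then have "card (idx n l) \<le> card (words s)"
    using assms(3) by (simp add: card_idx card_words)
  from card_le_inj[OF finite_idx finite_words this] that show thesis
    by blast
qed

text \<open>The coordinates \<open>k1\<close> and \<open>k2\<close> are never transposed, and their
  contribution splits into a row and a column function. The three segments around them are encoded
  as words, and transposing a factor becomes a partial transpose of its whole segment.\<close>

lemma block_decomp:
  fixes G1 G2 G3 :: "nat list \<Rightarrow> nat list \<Rightarrow> 'a::comm_ring_1" and g1 h1 g2 h2 :: "nat \<Rightarrow> 'a"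
  assumes n: "1 \<le> n" and k: "k1 < k2" "k2 < d"
    and m: "k1 \<le> m" "k2 - (k1 + 1) \<le> m" "d - (k2 + 1) \<le> m" "n ^ m \<le> 2 ^ s"
    and core: "decomp cut_products (word_sextuples s)
      (\<lambda>(i1, i2, i3, j1, j2, j3). of_bool (i1 = j1 \<and> i2 = j2 \<and> i3 = j3) :: 'a) R"
  shows "decomp (ptset d) (idx n d \<times> idx n d) (\<lambda>(i, j). (g1 (i ! k1) * g2 (i ! k2)) * (h1 (j ! k1) * h2 (j ! k2))
     * (G1 (seg 0 k1 i) (seg 0 k1 j) * G2 (seg (k1 + 1) k2 i) (seg (k1 + 1) k2 j)
         * G3 (seg (k2 + 1) d i) (seg (k2 + 1) d j))) R"
proof -
  obtain e1 where e1: "inj_on e1 (idx n k1)" "e1 ` idx n k1 \<subseteq> words s"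
    using encode_idx[OF n m(1,4)] by blast
  obtain e2 where e2: "inj_on e2 (idx n (k2 - (k1 + 1)))" "e2 ` idx n (k2 - (k1 + 1)) \<subseteq> words s"
    using encode_idx[OF n m(2,4)] by blast
  obtain e3 where e3: "inj_on e3 (idx n (d - (k2 + 1)))" "e3 ` idx n (d - (k2 + 1)) \<subseteq> words s"
    using encode_idx[OF n m(3,4)] by blast
  define s1 s2 s3 where "s1 x = e1 (seg 0 k1 x)" and "s2 x = e2 (seg (k1 + 1) k2 x)"
    and "s3 x = e3 (seg (k2 + 1) d x)" for x
  \<comment> \<open>Only encoded arguments are ever inserted, and on these \<open>inv_into\<close>
    decodes.\<close>
  define F1 where "F1 x y = G1 (inv_into (idx n k1) e1 x) (inv_into (idx n k1) e1 y)" for x y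
  define F2 where "F2 x y = G2 (inv_into (idx n (k2 - (k1 + 1))) e2 x) (inv_into (idx n (k2 - (k1 + 1))) e2 y)" for x y
  define F3 where "F3 x y = G3 (inv_into (idx n (d - (k2 + 1))) e3 x) (inv_into (idx n (d - (k2 + 1))) e3 y)" for x y
  have seg: "seg 0 k1 x \<in> idx n k1" "seg (k1 + 1) k2 x \<in> idx n (k2 - (k1 + 1))"
    "seg (k2 + 1) d x \<in> idx n (d - (k2 + 1))" if "x \<in> idx n d" for x
    using seg_idx[OF that, of k1 0] seg_idx[OF that, of k2 "k1 + 1"] seg_idx[OF that, of d "k2 + 1"] k by simp_all
  have F: "F1 (s1 i) (s1 j) = G1 (seg 0 k1 i) (seg 0 k1 j)"
    "F2 (s2 i) (s2 j) = G2 (seg (k1 + 1) k2 i) (seg (k1 + 1) k2 j)"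
    "F3 (s3 i) (s3 j) = G3 (seg (k2 + 1) d i) (seg (k2 + 1) d j)"
    if "i \<in> idx n d" "j \<in> idx n d" for i j
    using seg[OF that(1)] seg[OF that(2)] e1(1) e2(1) e3(1)
    by (simp_all only: F1_def F2_def F3_def s1_def s2_def s3_def inv_into_f_f)
  show ?thesis
  proof (rule decomp_map_on[OF product_decomp[OF core, of F1 F2 F3], where Q = "{()}"
      and \<phi> = "\<lambda>(i, j) _. (s1 i, s2 i, s3 i, s1 j, s2 j, s3 j)"
      and w = "\<lambda>(i, j) _. (g1 (i ! k1) * g2 (i ! k2)) * (h1 (j ! k1) * h2 (j ! k2))"], goal_cases)
    case (1 q)
    then show ?case using F by auto
  next
    case (2 q)
    then obtain i j where q: "q = (i, j)" "i \<in> idx n d" "j \<in> idx n d" by auto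
    then show ?case
      using seg[OF q(2)] seg[OF q(3)] e1(2) e2(2) e3(2)
      by (auto simp: word_sextuples_def s1_def s2_def s3_def)
  next
    case (3 t)
    then obtain a b u v where t: "t = (\<lambda>(i1, i2, i3, j1, j2, j3). u (if a then j1 else i1) i2 (if b then j3 else i3)
                * v (if a then i1 else j1) j2 (if b then i3 else j3))"
      unfolding cut_products_def by blast
    define \<kappa> where "\<kappa> = (if a then {0..<k1} else {}) \<union> (if b then {k2 + 1..<d} else {})"
    define U where "U x = g1 (x ! k1) * g2 (x ! k2) * u (s1 x) (s2 x) (s3 x)" for x
    define V where "V x = h1 (x ! k1) * h2 (x ! k2) * v (s1 x) (s2 x) (s3 x)" for x
    have \<kappa>: "\<kappa> \<subseteq> {..<d}"
      using k by (auto simp: \<kappa>_def)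
    have sel: "sel \<kappa> x y ! k1 = x ! k1" "sel \<kappa> x y ! k2 = x ! k2"
      "s1 (sel \<kappa> x y) = s1 (if a then y else x)" "s2 (sel \<kappa> x y) = s2 x"
      "s3 (sel \<kappa> x y) = s3 (if b then y else x)" if "x \<in> idx n d" for x y
    proof -
      have len: "length x = d"
        using that by (simp add: idx_def)
      show "sel \<kappa> x y ! k1 = x ! k1" "sel \<kappa> x y ! k2 = x ! k2"
        using k len by (auto simp: sel_def \<kappa>_def)
      have "seg 0 k1 (sel \<kappa> x y) = seg 0 k1 (if a then y else x)"
        using seg_sel[of k1 x 0 \<kappa> y] k len by (auto simp: \<kappa>_def)
      then show "s1 (sel \<kappa> x y) = s1 (if a then y else x)" by (simp add: s1_def)
      have "seg (k1 + 1) k2 (sel \<kappa> x y) = seg (k1 + 1) k2 x"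
        using k len by (intro seg_sel) (auto simp: \<kappa>_def)
      then show "s2 (sel \<kappa> x y) = s2 x" by (simp add: s2_def)
      have "seg (k2 + 1) d (sel \<kappa> x y) = seg (k2 + 1) d (if b then y else x)"
        using seg_sel[of d x "k2 + 1" \<kappa> y] k len by (auto simp: \<kappa>_def)
      then show "s3 (sel \<kappa> x y) = s3 (if b then y else x)" by (simp add: s3_def)
    qed
    have "(\<lambda>(i, j). U (sel \<kappa> i j) * V (sel \<kappa> j i)) \<in> ptset d"
      using \<kappa> by (auto simp: ptset_def)
    then show ?case
      by (rule bexI[rotated]) (auto simp: U_def V_def sel t mult_ac)
  qed
qed

section \<open>Ordered branching programs\<close>

lemma abp_vec_take: "k \<le> length x \<Longrightarrow> abp_vec w v1 A (x @ y) k = abp_vec w v1 A x k"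
  by (induction k) (auto simp: nth_append fun_eq_iff)

text \<open>The state after \<open>x\<close> is expanded in unit vectors, and by linearity the
  shifted program is run from each of them.\<close>

lemma abp_vec_append:
  fixes v1 :: "nat \<Rightarrow> 'a::comm_ring_1"
  assumes "m \<le> length y" "c < w (length x + m)"
  shows "abp_vec w v1 A (x @ y) (length x + m) c = (\<Sum>r<w (length x). abp_vec w v1 A x (length x) r
    * abp_vec (\<lambda>t. w (length x + t)) (\<lambda>c. of_bool (c = r)) (\<lambda>t. A (length x + t)) y m c)"
  using assms
proof (induction m arbitrary: c)
  case 0
  then show ?case by (simp add: abp_vec_take sum_of_bool)
next
  case (Suc m)
  let ?L = "abp_vec w v1 A x (length x)"
  let ?R = "\<lambda>r. abp_vec (\<lambda>t. w (length x + t)) (\<lambda>c. of_bool (c = r)) (\<lambda>t. A (length x + t)) y m"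
  have "abp_vec w v1 A (x @ y) (length x + Suc m) c
    = (\<Sum>q<w (length x + m). (\<Sum>r<w (length x). ?L r * ?R r q) * A (Suc (length x + m)) (y ! m) q c)"
    using Suc by (simp add: nth_append)
  also have "\<dots> = (\<Sum>q<w (length x + m). \<Sum>r<w (length x). ?L r * (?R r q * A (Suc (length x + m)) (y ! m) q c))"
    by (simp add: sum_distrib_right mult.assoc)
  also have "\<dots> = (\<Sum>r<w (length x). \<Sum>q<w (length x + m). ?L r * (?R r q * A (Suc (length x + m)) (y ! m) q c))"
    by (rule sum.swap)
  finally show ?case by (simp add: sum_distrib_left)
qed

lemma abp_eval_split:
  fixes w v1 v2 A
  obtains L N R where "\<And>x y z :: nat list. length x = lx \<Longrightarrow> length y = ly \<Longrightarrow> length z = lz \<Longrightarrow>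
    abp_eval w v1 v2 A (lx + ly + lz) (x @ y @ z)
      = (\<Sum>r<w lx. \<Sum>q<w (lx + ly). L r x * N r q y * (R q z :: 'a::comm_ring_1))"
proof -
  define L where "L r x = abp_vec w v1 A x lx r" for r x
  define N where "N r q y = abp_vec (\<lambda>t. w (lx + t)) (\<lambda>c. of_bool (c = r)) (\<lambda>t. A (lx + t)) y ly q" for r q y
  define R where "R q z = (\<Sum>c<w (lx + ly + lz). abp_vec (\<lambda>t. w (lx + ly + t)) (\<lambda>c. of_bool (c = q))
    (\<lambda>t. A (lx + ly + t)) z lz c * v2 c)" for q z
  have "abp_eval w v1 v2 A (lx + ly + lz) (x @ y @ z) = (\<Sum>r<w lx. \<Sum>q<w (lx + ly). L r x * N r q y * R q z)"
    if len: "length x = lx" "length y = ly" "length z = lz" for x y z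
  proof -
    have "abp_eval w v1 v2 A (lx + ly + lz) (x @ y @ z)
      = (\<Sum>c<w (lx + ly + lz). (\<Sum>q<w (lx + ly). abp_vec w v1 A (x @ y) (lx + ly) q
          * abp_vec (\<lambda>t. w (lx + ly + t)) (\<lambda>c. of_bool (c = q)) (\<lambda>t. A (lx + ly + t)) z lz c) * v2 c)"
      unfolding abp_eval_def
    proof (rule sum.cong[OF refl])
      fix c assume "c \<in> {..<w (lx + ly + lz)}"
      then show "abp_vec w v1 A (x @ y @ z) (lx + ly + lz) c * v2 c = (\<Sum>q<w (lx + ly). abp_vec w v1 A (x @ y) (lx + ly) q
          * abp_vec (\<lambda>t. w (lx + ly + t)) (\<lambda>c. of_bool (c = q)) (\<lambda>t. A (lx + ly + t)) z lz c) * v2 c"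
        using abp_vec_append[of lz z c w "x @ y" v1 A] len by simp
    qed
    also have "\<dots> = (\<Sum>c<w (lx + ly + lz). \<Sum>q<w (lx + ly). abp_vec w v1 A (x @ y) (lx + ly) q
          * (abp_vec (\<lambda>t. w (lx + ly + t)) (\<lambda>c. of_bool (c = q)) (\<lambda>t. A (lx + ly + t)) z lz c * v2 c))"
      by (simp add: sum_distrib_right mult.assoc)
    also have "\<dots> = (\<Sum>q<w (lx + ly). \<Sum>c<w (lx + ly + lz). abp_vec w v1 A (x @ y) (lx + ly) q
          * (abp_vec (\<lambda>t. w (lx + ly + t)) (\<lambda>c. of_bool (c = q)) (\<lambda>t. A (lx + ly + t)) z lz c * v2 c))"
      by (rule sum.swap)
    also have "\<dots> = (\<Sum>q<w (lx + ly). abp_vec w v1 A (x @ y) (lx + ly) q * R q z)"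
      by (simp add: R_def sum_distrib_left)
    also have "\<dots> = (\<Sum>q<w (lx + ly). (\<Sum>r<w lx. L r x * N r q y) * R q z)"
      using abp_vec_append[of ly y _ w x v1 A] len by (intro sum.cong) (auto simp: L_def N_def)
    also have "\<dots> = (\<Sum>q<w (lx + ly). \<Sum>r<w lx. L r x * N r q y * R q z)"
      by (simp add: sum_distrib_right)
    also have "\<dots> = (\<Sum>r<w lx. \<Sum>q<w (lx + ly). L r x * N r q y * R q z)"
      by (rule sum.swap)
    finally show ?thesis .
  qed
  with that show thesis by blast
qed

section \<open>Reading the matrix from the shifted tensor\<close>

definition mix :: "nat \<Rightarrow> nat list \<Rightarrow> nat list \<Rightarrow> nat list" where
  "mix n = map2 (\<lambda>j i. j * n + i)"

lemma mix_append: "length x = length x' \<Longrightarrow> mix n (x @ y) (x' @ y') = mix n x x' @ mix n y y'"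
  by (simp add: mix_def)

lemma mix_shifted:
  assumes "1 \<le> n" "1 \<le> d" "i \<in> idx n d" "j \<in> idx n d"
  shows "mix n (0 # j) (i @ [0]) \<in> idx (n ^ 2) (d + 1)"
    and "shifted_tensor n d M (mix n (0 # j) (i @ [0])) = M i j"
proof -
  let ?a = "mix n (0 # j) (i @ [0])"
  have len: "length i = d" "length j = d" and i: "\<And>k. k < d \<Longrightarrow> i ! k < n" and j: "\<And>k. k < d \<Longrightarrow> j ! k < n"
    using assms by (auto simp: idx_def)
  have lena: "length ?a = d + 1"
    using len by (simp add: mix_def)
  have a: "?a ! k = (0 # j) ! k * n + (i @ [0]) ! k" if "k < d + 1" for k
    using that len by (simp add: mix_def)
  have i': "(i @ [0]) ! k < n" if "k < d + 1" for k
    using that len i assms(1) by (auto simp: nth_append)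
  have j': "(0 # j) ! k < n" if "k < d + 1" for k
    using that len j assms(1) by (cases k) auto
  have "?a ! k < n ^ 2" if "k < d + 1" for k
  proof -
    have "?a ! k < ((0 # j) ! k + 1) * n"
      using a i' that by (simp add: algebra_simps)
    also have "\<dots> \<le> n * n"
      using j'[OF that] by (intro mult_right_mono) auto
    finally show ?thesis by (simp add: power2_eq_square)
  qed
  then show "?a \<in> idx (n ^ 2) (d + 1)"
    using lena by (auto simp: idx_def in_set_conv_nth)
  have div: "?a ! k div n = (0 # j) ! k" and mod: "?a ! k mod n = (i @ [0]) ! k" if "k < d + 1" for k
    using a[OF that] i'[OF that] assms(1) by (simp_all add: div_mult_self3 mod_mult_self3)
  have "map (\<lambda>k. ?a ! k mod n) [0..<d] = i"
    using len by (intro nth_equalityI) (simp_all add: mod nth_append)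
  moreover have "map (\<lambda>k. ?a ! Suc k div n) [0..<d] = j"
    using len by (intro nth_equalityI) (simp_all add: div)
  moreover have "?a ! 0 div n = 0" "?a ! d mod n = 0"
    using len by (simp_all add: div mod nth_append)
  ultimately show "shifted_tensor n d M ?a = M i j"
    by (simp add: shifted_tensor_def)
qed

lemma seg_split:
  assumes "length x = d" "k1 < k2" "k2 < d"
  shows "x = seg 0 k1 x @ [x ! k1] @ seg (k1 + 1) k2 x @ [x ! k2] @ seg (k2 + 1) d x"
proof -
  have "[0..<d] = [0..<k1] @ [k1..<d]" "[k1..<d] = k1 # [k1 + 1..<d]"
    "[k1 + 1..<d] = [k1 + 1..<k2] @ [k2..<d]" "[k2..<d] = k2 # [k2 + 1..<d]"
    using assms(2,3) upt_add_eq_append[of 0 k1 "d - k1"] upt_add_eq_append[of "k1 + 1" k2 "d - k2"]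
    by (simp_all add: upt_conv_Cons)
  then have "map ((!) x) [0..<d] = seg 0 k1 x @ [x ! k1] @ seg (k1 + 1) k2 x @ [x ! k2] @ seg (k2 + 1) d x"
    by (simp only: seg_def map_append list.map append.simps)
  then show ?thesis
    by (simp only: map_nth[of x] flip: assms(1))
qed

text \<open>The tensor index at position \<open>k1\<close> carries \<open>i ! k1\<close>, while
  \<open>j ! k1\<close> sits in the next one, so the cut between them sends the two values to
  different pieces. Fixing them at both cuts costs \<open>n^4\<close> terms, and the states at the
  cuts cost \<open>S^2\<close>.\<close>

lemma abp_rank:
  fixes M :: "nat list \<Rightarrow> nat list \<Rightarrow> 'a::field"
  assumes n: "1 \<le> n" and d: "6 \<le> d" and two: "(2::'a) \<noteq> 0"
    and s: "n ^ (d div 3) \<le> 2 ^ s"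
    and abp: "has_ord_abp (d + 1) (n ^ 2) (shifted_tensor n d M) S"
  shows "PT_rank n d M \<le> n * (n * (n * (n * (S * (S *
    ((s + 1) ^ 2 * (2 ^ s * card (few_matched (Suc (s div 3)) (2 * s)))))))))"
proof -
  let ?R = "(s + 1) ^ 2 * (2 ^ s * card (few_matched (Suc (s div 3)) (2 * s)))"
  define m where "m = d div 3"
  \<comment> \<open>This leaves segments of lengths \<open>m\<close>, \<open>m\<close> and
    \<open>d - 2 m - 2\<close>, the last at most \<open>m\<close> since
    \<open>d \<le> 3 m + 2\<close>.\<close>
  define k1 k2 where "k1 = m" and "k2 = 2 * m + 1"
  have k: "k1 < k2" "k2 < d" "k1 \<le> m" "k2 - (k1 + 1) \<le> m" "d - (k2 + 1) \<le> m"
    using d by (auto simp: k1_def k2_def m_def)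
  obtain w v1 v2 A where S: "(\<Sum>i\<le>d + 1. w i) \<le> S"
    and ev: "\<And>a. a \<in> idx (n ^ 2) (d + 1) \<Longrightarrow> shifted_tensor n d M a = abp_eval w v1 v2 A (d + 1) a"
    using abp unfolding has_ord_abp_def by blast
  obtain L N R where LNR: "\<And>x y z. length x = k1 + 1 \<Longrightarrow> length y = k2 - k1 \<Longrightarrow> length z = d - k2 \<Longrightarrow>
    abp_eval w v1 v2 A (k1 + 1 + (k2 - k1) + (d - k2)) (x @ y @ z)
      = (\<Sum>r<w (k1 + 1). \<Sum>q<w (k1 + 1 + (k2 - k1)). L r x * N r q y * R q z)"
    by (rule abp_eval_split[of "k1 + 1" "k2 - k1" "d - k2" w v1 v2 A]) blast
  have len: "k1 + 1 + (k2 - k1) + (d - k2) = d + 1" "k1 + 1 + (k2 - k1) = k2 + 1"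
    using k by auto
  define G1 where "G1 p r I J = L r (mix n (0 # J) (I @ [p]))" for p r I J
  define G2 where "G2 p q r t I J = N r t (mix n (q # J) (I @ [p]))" for p q r t I J
  define G3 where "G3 q t I J = R t (mix n (q # J) (I @ [0]))" for q t I J
  define f where "f p q p' q' r t = (\<lambda>(i, j). (of_bool (i ! k1 = p) * of_bool (i ! k2 = p'))
     * (of_bool (j ! k1 = q) * of_bool (j ! k2 = q'))
     * (G1 p r (seg 0 k1 i) (seg 0 k1 j) * G2 p' q r t (seg (k1 + 1) k2 i) (seg (k1 + 1) k2 j)
         * G3 q' t (seg (k2 + 1) d i) (seg (k2 + 1) d j)))" for p q p' q' r t
  have core: "decomp cut_products (word_sextuples s)
      (\<lambda>(i1, i2, i3, j1, j2, j3). of_bool (i1 = j1 \<and> i2 = j2 \<and> i3 = j3) :: 'a) ?R"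
    by (rule threefold_identity_decomp[OF two])
  have "decomp (ptset d) (idx n d \<times> idx n d) (\<lambda>ij. \<Sum>p<n. \<Sum>q<n. \<Sum>p'<n. \<Sum>q'<n. \<Sum>r<w (k1 + 1). \<Sum>t<w (k2 + 1). f p q p' q' r t ij)
    (card {..<n} * (card {..<n} * (card {..<n} * (card {..<n} * (card {..<w (k1 + 1)} * (card {..<w (k2 + 1)} * ?R))))))"
    using s unfolding f_def m_def[symmetric]
    by (intro decomp_sum finite_lessThan block_decomp[OF n k _ core])
  moreover have wS: "w l \<le> S" if "l \<le> d + 1" for l
    using member_le_sum[of l "{..d + 1}" w] that S by simp
  ultimately have "decomp (ptset d) (idx n d \<times> idx n d) (\<lambda>ij. \<Sum>p<n. \<Sum>q<n. \<Sum>p'<n. \<Sum>q'<n. \<Sum>r<w (k1 + 1). \<Sum>t<w (k2 + 1). f p q p' q' r t ij)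
    (n * (n * (n * (n * (S * (S * ?R))))))"
    using k by (elim decomp_mono) (auto intro!: mult_mono)
  then have "decomp (ptset d) (idx n d \<times> idx n d) (\<lambda>(i, j). M i j) (n * (n * (n * (n * (S * (S * ?R))))))"
  proof (rule decomp_cong)
    fix ij assume "ij \<in> idx n d \<times> idx n d"
    then obtain i j where ij: "ij = (i, j)" and i: "i \<in> idx n d" and j: "j \<in> idx n d" by auto
    have leni: "length i = d" "length j = d"
      using i j by (auto simp: idx_def)
    have mem: "i ! k1 \<in> {..<n}" "i ! k2 \<in> {..<n}" "j ! k1 \<in> {..<n}" "j ! k2 \<in> {..<n}"
      using i j k by (auto simp: idx_def)
    let ?x = "mix n (0 # seg 0 k1 j) (seg 0 k1 i @ [i ! k1])"
    let ?y = "mix n (j ! k1 # seg (k1 + 1) k2 j) (seg (k1 + 1) k2 i @ [i ! k2])"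
    let ?z = "mix n (j ! k2 # seg (k2 + 1) d j) (seg (k2 + 1) d i @ [0])"
    have a: "mix n (0 # j) (i @ [0]) = ?x @ ?y @ ?z"
    proof -
      have "0 # j = (0 # seg 0 k1 j) @ (j ! k1 # seg (k1 + 1) k2 j) @ (j ! k2 # seg (k2 + 1) d j)"
        using seg_split[OF leni(2) k(1,2)] by simp
      moreover have "i @ [0] = (seg 0 k1 i @ [i ! k1]) @ (seg (k1 + 1) k2 i @ [i ! k2]) @ (seg (k2 + 1) d i @ [0])"
        using seg_split[OF leni(1) k(1,2)] by simp
      ultimately show ?thesis
        by (simp only: mix_append length_append length_Cons list.size seg_def length_map length_upt add_Suc_right add_0_right)
    qed
    have d1: "1 \<le> d" using d by simp
    have "M i j = shifted_tensor n d M (mix n (0 # j) (i @ [0]))"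
      by (rule mix_shifted(2)[OF n d1 i j, symmetric])
    also have "\<dots> = abp_eval w v1 v2 A (d + 1) (mix n (0 # j) (i @ [0]))"
      by (rule ev[OF mix_shifted(1)[OF n d1 i j]])
    also have "\<dots> = (\<Sum>r<w (k1 + 1). \<Sum>t<w (k2 + 1). L r ?x * N r t ?y * R t ?z)"
      unfolding a using LNR[of ?x ?y ?z] k unfolding len by (simp add: mix_def seg_def)
    \<comment> \<open>The four coordinate values become summation indices guarded by indicators,
      which gives the form required by \<open>block_decomp\<close>.\<close>
    also have "\<dots> = (\<Sum>p<n. of_bool (i ! k1 = p) * (\<Sum>q<n. of_bool (j ! k1 = q) * (\<Sum>p'<n. of_bool (i ! k2 = p') *
       (\<Sum>q'<n. of_bool (j ! k2 = q') * (\<Sum>r<w (k1 + 1). \<Sum>t<w (k2 + 1).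
         G1 p r (seg 0 k1 i) (seg 0 k1 j) * G2 p' q r t (seg (k1 + 1) k2 i) (seg (k1 + 1) k2 j)
         * G3 q' t (seg (k2 + 1) d i) (seg (k2 + 1) d j))))))"
      using mem by (simp only: sum_of_bool finite_lessThan G1_def G2_def G3_def)
    also have "\<dots> = (\<Sum>p<n. \<Sum>q<n. \<Sum>p'<n. \<Sum>q'<n. \<Sum>r<w (k1 + 1). \<Sum>t<w (k2 + 1). f p q p' q' r t ij)"
      by (simp only: f_def ij prod.case sum_distrib_left mult_ac)
    finally show "(case ij of (i, j) \<Rightarrow> M i j) = (\<Sum>p<n. \<Sum>q<n. \<Sum>p'<n. \<Sum>q'<n. \<Sum>r<w (k1 + 1). \<Sum>t<w (k2 + 1). f p q p' q' r t ij)"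
      by (simp add: ij)
  qed
  then show ?thesis
    by (rule PT_rank_le)
qed

section \<open>Growth estimates\<close>

lemma power_le_exp:
  obtains B :: real where "1 \<le> B" "\<And>x. 0 \<le> x \<Longrightarrow> x ^ k \<le> B * exp x"
proof -
  have "eventually (\<lambda>x::real. x ^ k / exp x < 1) at_top"
    using tendsto_power_div_exp_0[of k] by (rule order_tendstoD) simp
  then obtain X :: real where X: "\<forall>x\<ge>X. x ^ k / exp x < 1"
    unfolding eventually_at_top_linorder by blast
  have "x ^ k \<le> (1 + \<bar>X\<bar> ^ k) * exp x" if "0 \<le> x" for x
  proof (cases "x \<ge> X")
    case True
    then have "x ^ k \<le> 1 * exp x" using X by (simp add: pos_divide_less_eq less_imp_le)
    also have "\<dots> \<le> (1 + \<bar>X\<bar> ^ k) * exp x" by (intro mult_right_mono) auto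
    finally show ?thesis .
  next
    case False
    then have "x ^ k \<le> \<bar>X\<bar> ^ k" using that by (intro power_mono) auto
    also have "\<dots> \<le> (1 + \<bar>X\<bar> ^ k) * 1" by simp
    also have "\<dots> \<le> (1 + \<bar>X\<bar> ^ k) * exp x" using that by (intro mult_left_mono) auto
    finally show ?thesis .
  qed
  with that[of "1 + \<bar>X\<bar> ^ k"] show thesis by simp
qed

lemma poly_le_powr:
  fixes \<epsilon> :: real
  assumes "0 < \<epsilon>"
  obtains B :: real where "1 \<le> B" "\<And>s. (real s + 1) ^ k \<le> B * 2 powr (\<epsilon> * real s)"
proof -
  obtain B where B: "1 \<le> B" "\<And>x::real. 0 \<le> x \<Longrightarrow> x ^ k \<le> B * exp x"
    using power_le_exp[of k] by blast
  define a where "a = \<epsilon> * ln 2"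
  have a: "0 < a" using assms by (simp add: a_def)
  define B' where "B' = B * exp a / a ^ k"
  have "(real s + 1) ^ k \<le> max 1 B' * 2 powr (\<epsilon> * real s)" for s
  proof -
    have "(a * (real s + 1)) ^ k \<le> B * exp (a * (real s + 1))"
      using a by (intro B) simp
    then have "a ^ k * (real s + 1) ^ k \<le> B * (exp (a * real s) * exp a)"
      unfolding power_mult_distrib by (simp add: distrib_left exp_add)
    then have "(a ^ k * (real s + 1) ^ k) / a ^ k \<le> (B * (exp (a * real s) * exp a)) / a ^ k"
      using a by (intro divide_right_mono) auto
    then have "(real s + 1) ^ k \<le> B' * exp (a * real s)"
      using a by (simp add: B'_def mult_ac)
    also have "\<dots> \<le> max 1 B' * exp (a * real s)"
      by (intro mult_right_mono) auto
    also have "exp (a * real s) = 2 powr (\<epsilon> * real s)"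
      by (simp add: powr_def a_def mult_ac)
    finally show ?thesis .
  qed
  with that[of "max 1 B'"] show thesis by simp
qed

text \<open>The identity gives \<open>2^s\<close>, the power of 8 at most \<open>2^s\<close>, and
  the Chernoff sum \<open>(9/8)^(2s)\<close>, together \<open>(81/16)^s\<close>.\<close>

lemma few_matched_bound:
  "real (2 ^ s * card (few_matched (Suc (s div 3)) (2 * s))) \<le> 2 powr (2.4 * real s) * (2 * (real s + 1))"
proof -
  have "(8::real) ^ (s div 3) = 2 ^ (3 * (s div 3))"
    by (simp add: power_mult)
  also have "\<dots> \<le> 2 ^ s"
    by (intro power_increasing) auto
  finally have 8: "(8::real) ^ (s div 3) \<le> 2 ^ s" .
  have "((2::real) powr (12 / 5)) ^ 5 = 2 powr real 12"
    by (subst powr_power) simp_all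
  also have "\<dots> = 2 ^ 12"
    by (rule powr_realpow) simp
  \<comment> \<open>On fifth powers the comparison reads \<open>81^5 \<le> 2^32\<close>.\<close>
  finally have "(81 / 16 :: real) ^ Suc 4 \<le> (2 powr (12 / 5)) ^ Suc 4"
    by (simp add: power_divide)
  then have "(81 / 16 :: real) \<le> 2 powr (12 / 5)"
    by (rule power_le_imp_le_base) simp
  then have b: "(81 / 16 :: real) ^ s \<le> (2 powr (12 / 5)) ^ s"
    by (intro power_mono) auto
  have "real (2 ^ s * card (few_matched (Suc (s div 3)) (2 * s)))
      \<le> 2 ^ s * (8 ^ (s div 3) * ((9 / 8) ^ (2 * s) * (1 + real (2 * s))))"
    using card_few_matched[of "s div 3" "2 * s"] by simp
  also have "\<dots> \<le> 2 ^ s * (2 ^ s * ((9 / 8) ^ (2 * s) * (1 + real (2 * s))))"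
    using 8 by (intro mult_left_mono mult_right_mono) auto
  also have "\<dots> = (81 / 16) ^ s * (1 + 2 * real s)"
  proof -
    have "(81 / 16 :: real) = 2 * 2 * (9 / 8) ^ 2"
      by (simp add: power2_eq_square)
    then have "(81 / 16 :: real) ^ s = 2 ^ s * 2 ^ s * (9 / 8) ^ (2 * s)"
      by (simp only: power_mult_distrib power_mult)
    then show ?thesis by simp
  qed
  also have "\<dots> \<le> (2 powr (12 / 5)) ^ s * (2 * (real s + 1))"
    using b by (intro mult_mono) auto
  also have "(2 powr (12 / 5)) ^ s = (2::real) powr (2.4 * real s)"
    by (subst powr_power) (auto simp: mult.commute)
  finally show ?thesis .
qed

text \<open>The exponent \<open>2.4\<close> plus \<open>0.03\<close> for all polynomial factors in
  \<open>s\<close> is \<open>2.43 = 3 * 0.81\<close>, and \<open>2 ^ s\<close> is within a factor 2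
  of \<open>n ^ (d div 3)\<close>.\<close>

lemma size_bound:
  fixes c :: nat
  obtains C :: real where "0 \<le> C"
    "\<And>n d s. 2 \<le> n \<Longrightarrow> n ^ (d div 3) \<le> 2 ^ s \<Longrightarrow> 2 ^ s \<le> 2 * n ^ (d div 3) \<Longrightarrow>
      real (n * (n * (n * (n * (c * ((d + 1) * n ^ 2) ^ c * (c * ((d + 1) * n ^ 2) ^ c *
        ((s + 1) ^ 2 * (2 ^ s * card (few_matched (Suc (s div 3)) (2 * s)))))))))) \<le> real n powr (0.81 * real d + C)"
proof -
  \<comment> \<open>Since \<open>d + 1 \<le> 3 * (s + 1)\<close>, the two program sizes contribute
    \<open>2 * c\<close> powers; the number of monomials contributes two and the Chernoff bound
    one.\<close>
  obtain B :: real where B: "1 \<le> B" "\<And>s. (real s + 1) ^ (2 * c + 3) \<le> B * 2 powr (0.03 * real s)"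
    using poly_le_powr[of "0.03" "2 * c + 3"] by auto
  \<comment> \<open>\<open>2 powr 2.43\<close> pays for rounding up to a power of two;
    \<open>D\<close> is later absorbed into \<open>n ^ b\<close>, as
    \<open>n \<ge> 2\<close>.\<close>
  define D where "D = 2 * real c ^ 2 * 9 ^ c * B * 2 powr 2.43"
  obtain b where b: "D < 2 ^ b"
    using real_arch_pow[of 2 D] by auto
  define C where "C = real (4 + 4 * c + b)"
  have main: "real (n * (n * (n * (n * (c * ((d + 1) * n ^ 2) ^ c * (c * ((d + 1) * n ^ 2) ^ c *
        ((s + 1) ^ 2 * (2 ^ s * card (few_matched (Suc (s div 3)) (2 * s)))))))))) \<le> real n powr (0.81 * real d + C)"
    if n: "2 \<le> n" and s: "n ^ (d div 3) \<le> 2 ^ s" "2 ^ s \<le> 2 * n ^ (d div 3)" for n d s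
  proof -
    define m where "m = d div 3"
    define g where "g = 2 ^ s * card (few_matched (Suc (s div 3)) (2 * s))"
    have "(2::nat) ^ m \<le> n ^ m"
      using n by (intro power_mono) auto
    also have "n ^ m \<le> 2 ^ s"
      using s(1) by (simp only: m_def)
    finally have "(2::nat) ^ m \<le> 2 ^ s" .
    then have "m \<le> s" by (rule power_le_imp_le_exp[rotated]) simp
    then have ds: "real d + 1 \<le> 3 * (real s + 1)"
      by (simp add: m_def)
    define a e where "a = (real d + 1) ^ c" and "e = real n ^ (2 * c)"
    have pow: "real n ^ (4 + 4 * c) = real n ^ 4 * (e * e)" "(real d + 1) ^ (2 * c) = a * a"
    proof -
      have "4 + 4 * c = 4 + (2 * c + 2 * c)" by simp
      then show "real n ^ (4 + 4 * c) = real n ^ 4 * (e * e)"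
        unfolding e_def by (simp only: power_add)
      show "(real d + 1) ^ (2 * c) = a * a"
        unfolding a_def by (simp only: mult_2 power_add)
    qed
    have ae: "real (((d + 1) * n ^ 2) ^ c) = a * e"
      by (simp only: a_def e_def of_nat_power of_nat_mult of_nat_add of_nat_1 power_mult_distrib power_mult)
    have "real (n * (n * (n * (n * (c * ((d + 1) * n ^ 2) ^ c * (c * ((d + 1) * n ^ 2) ^ c * ((s + 1) ^ 2 * g)))))))
      = real n * (real n * (real n * (real n * (real c * (a * e) * (real c * (a * e) * ((real s + 1) ^ 2 * real g))))))"
      unfolding of_nat_mult ae by (simp add: add.commute)
    also have "\<dots> = real n ^ (4 + 4 * c) * (real c ^ 2 * ((real d + 1) ^ (2 * c) * ((real s + 1) ^ 2 * real g)))"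
      unfolding pow by (simp only: power2_eq_square power4_eq_xxxx mult_ac)
    also have "\<dots> \<le> real n ^ (4 + 4 * c) * (real c ^ 2 * ((3 * (real s + 1)) ^ (2 * c) * ((real s + 1) ^ 2 *
        (2 powr (2.4 * real s) * (2 * (real s + 1))))))"
      using few_matched_bound[of s] ds unfolding g_def[symmetric]
      by (intro mult_left_mono mult_mono power_mono) auto
    also have "\<dots> = real n ^ (4 + 4 * c) * (2 * real c ^ 2 * 9 ^ c * (2 powr (2.4 * real s) * (real s + 1) ^ (2 * c + 3)))"
    proof -
      have *: "(3 * t) ^ (2 * c) * (t ^ 2 * (P * (2 * t))) = 2 * 9 ^ c * (P * t ^ (2 * c + 3))" for t P :: real
      proof -
        have 9: "(3 :: real) ^ (2 * c) = 9 ^ c"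
          by (simp add: power_mult)
        show ?thesis
          unfolding power_mult_distrib 9 by (simp only: power_add power2_eq_square power3_eq_cube mult_ac)
      qed
      show ?thesis unfolding * by (simp only: mult_ac)
    qed
    also have "\<dots> \<le> real n ^ (4 + 4 * c) * (2 * real c ^ 2 * 9 ^ c * (2 powr (2.4 * real s) * (B * 2 powr (0.03 * real s))))"
      by (intro mult_left_mono B) auto
    also have "\<dots> = real n ^ (4 + 4 * c) * (2 * real c ^ 2 * 9 ^ c * B * (2 powr real s) powr 2.43)"
      by (simp add: powr_powr mult_ac flip: powr_add)
    also have "\<dots> \<le> real n ^ (4 + 4 * c) * (2 * real c ^ 2 * 9 ^ c * B * (2 * real n powr real m) powr 2.43)"
    proof -
      have "real (2 ^ s) \<le> real (2 * n ^ m)"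
        using s(2) unfolding m_def by (simp only: of_nat_le_iff)
      then have "2 powr real s \<le> 2 * real n powr real m"
        using n by (simp add: powr_realpow)
      then show ?thesis
        using B(1) by (intro mult_left_mono powr_mono2) auto
    qed
    also have "\<dots> = real n ^ (4 + 4 * c) * (D * real n powr (2.43 * real m))"
      by (simp add: D_def powr_mult powr_powr mult_ac)
    also have "\<dots> \<le> real n ^ (4 + 4 * c) * (real n ^ b * real n powr (0.81 * real d))"
    proof -
      have "D \<le> real n ^ b"
        using b power_mono[of 2 "real n" b] n by simp
      moreover have "real n powr (2.43 * real m) \<le> real n powr (0.81 * real d)"
        using n by (intro powr_mono) (auto simp: m_def)
      ultimately show ?thesis
        by (intro mult_left_mono mult_mono) auto
    qed
    also have "\<dots> = real n powr (0.81 * real d + C)"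
    proof -
      have "real n powr C = real n ^ (4 + 4 * c) * real n ^ b"
        unfolding C_def using n by (subst powr_realpow) (simp, simp only: power_add)
      then show ?thesis
        by (simp only: powr_add mult_ac)
    qed
    finally show ?thesis by (simp only: g_def)
  qed
  show thesis
    by (rule that[OF _ main]) (auto simp: C_def)
qed

theorem theorem6p6:
  fixes M :: "nat \<Rightarrow> nat list \<Rightarrow> nat list \<Rightarrow> 'a::field"
    and d :: "nat \<Rightarrow> nat"
  assumes "CHAR('a) \<noteq> 2"
    and "in_VBP_ord (\<lambda>n. d n + 1) (\<lambda>n. n ^ 2) (\<lambda>n. shifted_tensor n (d n) (M n))"
  shows "\<exists>C::real. \<forall>n\<ge>1. real (PT_rank n (d n) (M n)) \<le> real n powr (0.81 * real (d n) + C)"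
proof -
  obtain c where c: "\<And>n. 1 \<le> n \<Longrightarrow>
      has_ord_abp (d n + 1) (n ^ 2) (shifted_tensor n (d n) (M n)) (c * ((d n + 1) * n ^ 2) ^ c)"
    using assms(2) unfolding in_VBP_ord_def by blast
  obtain C where C: "0 \<le> C" "\<And>n d s. 2 \<le> n \<Longrightarrow> n ^ (d div 3) \<le> 2 ^ s \<Longrightarrow> 2 ^ s \<le> 2 * n ^ (d div 3) \<Longrightarrow>
      real (n * (n * (n * (n * (c * ((d + 1) * n ^ 2) ^ c * (c * ((d + 1) * n ^ 2) ^ c *
        ((s + 1) ^ 2 * (2 ^ s * card (few_matched (Suc (s div 3)) (2 * s)))))))))) \<le> real n powr (0.81 * real d + C)"
    using size_bound[of c] by blast
  \<comment> \<open>The 12 covers \<open>d n < 6\<close>, where the trivial exponent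
    \<open>2 * d n\<close> is at most 10.\<close>
  have "real (PT_rank n (d n) (M n)) \<le> real n powr (0.81 * real (d n) + (C + 12))" if n: "1 \<le> n" for n
  proof -
    have triv: "real (PT_rank n (d n) (M n)) \<le> real n powr real (2 * d n)"
    proof -
      have "real (PT_rank n (d n) (M n)) \<le> real (n ^ (2 * d n))"
        by (simp only: of_nat_le_iff PT_rank_trivial)
      also have "\<dots> = real n powr real (2 * d n)"
        using n by (subst powr_realpow) simp_all
      finally show ?thesis .
    qed
    consider "n = 1" | "d n < 6" | "2 \<le> n" "6 \<le> d n"
      using n by linarith
    then show ?thesis
    proof cases
      case 1
      then show ?thesis using triv by simp
    next
      case 2
      have "real n powr real (2 * d n) \<le> real n powr (0.81 * real (d n) + (C + 12))"
        using n 2 C(1) by (intro powr_mono) auto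
      with triv show ?thesis by simp
    next
      case 3
      \<comment> \<open>Minimality keeps \<open>2 ^ s\<close> within twice the required
        dimension.\<close>
      define s where "s = (LEAST s. n ^ (d n div 3) \<le> 2 ^ s)"
      have s: "n ^ (d n div 3) \<le> 2 ^ s"
        unfolding s_def by (rule LeastI[of _ "n ^ (d n div 3)"]) (simp add: less_imp_le)
      have "2 ^ s \<le> 2 * n ^ (d n div 3)"
      proof (cases s)
        case 0
        then show ?thesis using n by simp
      next
        case (Suc s')
        then have "\<not> n ^ (d n div 3) \<le> 2 ^ s'"
          using not_less_Least[of s' "\<lambda>s. n ^ (d n div 3) \<le> 2 ^ s"] by (simp add: s_def)
        then show ?thesis by (simp add: Suc)
      qed
      note bound = C(2)[OF 3(1) s this]
      have "PT_rank n (d n) (M n) \<le> n * (n * (n * (n * (c * ((d n + 1) * n ^ 2) ^ c * (c * ((d n + 1) * n ^ 2) ^ c *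
          ((s + 1) ^ 2 * (2 ^ s * card (few_matched (Suc (s div 3)) (2 * s)))))))))"
        by (rule abp_rank[OF n 3(2) CHAR_2_field[OF assms(1)] s c[OF n]])
      then have "real (PT_rank n (d n) (M n)) \<le> real n powr (0.81 * real (d n) + C)"
        using bound by linarith
      also have "\<dots> \<le> real n powr (0.81 * real (d n) + (C + 12))"
        using n by (intro powr_mono) auto
      finally show ?thesis .
    qed
  qed
  then show ?thesis by blast
qed

end
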